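(* Let $\mu\in\mathbb{C}$ and let $m\ge1$, $n\ge0$ be integers. Put $$u_{m,n}(z;\mu)=-\frac{T_{m,n}^{(\mu)}(z)\,T_{m-2,n+1}^{(\mu)}(z)}{T_{m-1,n}^{(\mu+1)}(z)\,T_{m-1,n+1}^{(\mu-1)}(z)} .$$ Then $u_{m,n}(z;\mu)=\frac{d}{dz}\ln\frac{T_{m-1,n+1}^{(\mu-1)}(z)}{T_{m-1,n}^{(\mu+1)}(z)}$, and each of the following pairs $(u,v)$ with $u=u_{m,n}(z;\mu)$ is a rational solution of the system $$z\frac{du}{dz}=z(2v-1)u^2-(2zv-z+\kappa_1+\kappa_3)u+\kappa_1,\qquad z\frac{dv}{dz}=z(1-2u)v^2+(2zu-z-\kappa_2-\kappa_4)v+\kappa_2$$ for the indicated parameters $\boldsymbol\kappa=(\kappa_1,\kappa_2,\kappa_3,\kappa_4)$ (which satisfy $\kappa_1+\kappa_2+\kappa_3+\kappa_4=1$); moreover the two expressions given for $v$ coincide. (i) $\boldsymbol\kappa=(m,\,-m-n,\,\mu+m+2n+1,\,-m-n-\mu)$ and $$v=-\frac{m+n}{z}\,\frac{T_{m-1,n+1}^{(\mu-1)}(z)\,T_{m-2,n}^{(\mu+1)}(z)}{T_{m-1,n}^{(\mu)}(z)\,T_{m-2,n+1}^{(\mu)}(z)}=1-\frac{\mu+2n+1}{z}+\frac{d}{dz}\ln\frac{T_{m-1,n}^{(\mu)}(z)}{T_{m-2,n+1}^{(\mu)}(z)} .$$ (ii) $\boldsymbol\kappa=(m,\,\mu+n+1,\,-\mu-m-2n-1,\,n+1)$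 and $$v=\frac{T_{m-1,n+1}^{(\mu-1)}(z)\,T_{m-2,n+1}^{(\mu+1)}(z)}{T_{m-1,n+1}^{(\mu)}(z)\,T_{m-2,n+1}^{(\mu)}(z)}=1+\frac{d}{dz}\ln\frac{T_{m-1,n+1}^{(\mu)}(z)}{T_{m-2,n+1}^{(\mu)}(z)} .$$ (iii) $\boldsymbol\kappa=(-m,\,-n,\,\mu+m+2n+1,\,-n-\mu)$ and, for $n\ge1$, $$v=-\frac{T_{m,n-1}^{(\mu+1)}(z)\,T_{m-1,n+1}^{(\mu-1)}(z)}{T_{m-1,n}^{(\mu)}(z)\,T_{m,n}^{(\mu)}(z)}=\frac{d}{dz}\ln\frac{T_{m-1,n}^{(\mu)}(z)}{T_{m,n}^{(\mu)}(z)},$$ while $v=0$ for $n=0$. (iv) $\boldsymbol\kappa=(-m,\,\mu+m+n+1,\,-\mu-m-2n-1,\,m+n+1)$ and $$v=\frac{\mu+m+n+1}{z}\,\frac{T_{m,n}^{(\mu+1)}(z)\,T_{m-1,n+1}^{(\mu-1)}(z)}{T_{m,n}^{(\mu)}(z)\,T_{m-1,n+1}^{(\mu)}(z)}=\frac{\mu+2n+1}{z}+\frac{d}{dz}\ln\frac{T_{m-1,n+1}^{(\mu)}(z)}{T_{m,n}^{(\mu)}(z)} .$$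
   Context: $L_n^{(\alpha)}(z)=\sum_{i=0}^n \frac{(-1)^i}{i!\,(n-i)!}\Big(\prod_{l=i+1}^{n}(\alpha+l)\Big)z^i$ is the associated Laguerre polynomial ($n\ge0$, any complex $\alpha$). The generalised Laguerre polynomial is $T_{m,n}^{(\mu)}(z)=\det\left[\frac{d^{j+k}}{dz^{j+k}}L_{m+n}^{(\mu+1)}(z)\right]_{j,k=0}^{n-1}$ for integers $m\ge-1$, $n\ge1$ (for $m=-1$ this is a nonzero constant), and $T_{m,0}^{(\mu)}(z)=1$. The system for $(u,v)$ is the form of the symmetric fifth Painlevé system used for the two functions $u,v$, where $\kappa_1,\dots,\kappa_4$ are constants with sum $1$. *)

theory Defs
  imports "HOL-Analysis.Analysis" "Jordan_Normal_Form.Determinant"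
begin

definition laguerre_poly :: "nat \<Rightarrow> complex \<Rightarrow> complex poly" where
  "laguerre_poly n \<alpha> =
     (\<Sum>i\<le>n. monom ((-1) ^ i / (fact i * fact (n - i)) * (\<Prod>l\<in>{i+1..n}. \<alpha> + of_nat l)) i)"

(* Meaningful for m \<ge> -1. If also n \<ge> 1, then m + n \<ge> 0, so that nat loses nothing. *)
definition gen_laguerre_poly :: "int \<Rightarrow> nat \<Rightarrow> complex \<Rightarrow> complex poly" where
  "gen_laguerre_poly m n \<mu> =
     (if n = 0 then 1
      else Determinant.det (Matrix.mat n n (\<lambda>(j, k).
             (pderiv ^^ (j + k)) (laguerre_poly (nat (m + int n)) (\<mu> + 1)))))"

definition T :: "int \<Rightarrow> nat \<Rightarrow> complex \<Rightarrow> complex \<Rightarrow> complex" where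
  "T m n \<mu> z = poly (gen_laguerre_poly m n \<mu>) z"

(* d/dz ln f, read as the logarithmic derivative: no branch of ln is involved. *)
definition log_deriv :: "(complex \<Rightarrow> complex) \<Rightarrow> complex \<Rightarrow> complex" where
  "log_deriv f z = deriv f z / f z"

(* Division is total in HOL, so a rational function comes with a set D off its poles.
   D has finite complement, hence D is nonempty and open, and determines the function. *)
definition rational_function_on :: "complex set \<Rightarrow> (complex \<Rightarrow> complex) \<Rightarrow> bool" where
  "rational_function_on D f \<longleftrightarrow>
     finite (- D) \<and> (\<exists>p q. \<forall>z\<in>D. poly q z \<noteq> 0 \<and> f z = poly p z / poly q z)"

definition rational_PV_solution_on ::
  "complex set \<Rightarrow> complex \<times> complex \<times> complex \<times> complex \<Rightarrow>
   (complex \<Rightarrow> complex) \<Rightarrow> (complex \<Rightarrow> complex) \<Rightarrow> bool" where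
  "rational_PV_solution_on D \<kappa> u v \<longleftrightarrow>
     (case \<kappa> of (\<kappa>1, \<kappa>2, \<kappa>3, \<kappa>4) \<Rightarrow>
        \<kappa>1 + \<kappa>2 + \<kappa>3 + \<kappa>4 = 1 \<and>
        rational_function_on D u \<and> rational_function_on D v \<and>
        (\<forall>z\<in>D. u field_differentiable (at z) \<and> v field_differentiable (at z) \<and>
           z * deriv u z =
             z * (2 * v z - 1) * (u z)\<^sup>2 - (2 * z * v z - z + \<kappa>1 + \<kappa>3) * u z + \<kappa>1 \<and>
           z * deriv v z =
             z * (1 - 2 * u z) * (v z)\<^sup>2 + (2 * z * u z - z - \<kappa>2 - \<kappa>4) * v z + \<kappa>2))"

definition u_fun :: "int \<Rightarrow> nat \<Rightarrow> complex \<Rightarrow> complex \<Rightarrow> complex" where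
  "u_fun m n \<mu> z =
     - (T m n \<mu> z * T (m - 2) (n + 1) \<mu> z) /
       (T (m - 1) n (\<mu> + 1) z * T (m - 1) (n + 1) (\<mu> - 1) z)"

definition u_dom :: "int \<Rightarrow> nat \<Rightarrow> complex \<Rightarrow> complex set" where
  "u_dom m n \<mu> = {z. T (m - 1) n (\<mu> + 1) z \<noteq> 0 \<and> T (m - 1) (n + 1) (\<mu> - 1) z \<noteq> 0}"

end

theory Submission
  imports Defs
begin

text \<open>Write \<open>f\<close> for the Laguerre polynomial \<open>L\<^sub>N\<^sup>(\<^sup>\<mu>\<^sup>)\<close> with \<open>N = m + n\<close>. Since \<open>L\<^sub>N\<^sub>-\<^sub>1\<^sup>(\<^sup>\<mu>\<^sup>+\<^sup>1\<^sup>) = - f'\<close> and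
  \<open>L\<^sub>N\<^sup>(\<^sup>\<mu>\<^sup>+\<^sup>1\<^sup>) = f - f'\<close>, all the generalised Laguerre polynomials involved are, up to sign, Hankel
  determinants of the functions obtained from \<open>f\<close> by applying \<open>D\<close> and \<open>D - 1\<close>. If \<open>f\<close> is regarded as the
  zeroth moment of a weight \<open>e\<^sup>z\<^sup>x \<rho>(x)\<close>, these two operators multiply the weight by \<open>x\<close> and \<open>x - 1\<close>.
  The Desnanot--Jacobi identity for such determinants implies, by induction on their size and by
  cancelling nonzero polynomials, all the bilinear relations of the Toda lattice. In terms of
  \<open>u\<^sub>n = u\<^bsub>N-n,n\<^esub>\<close> and of the function \<open>v\<^sub>n\<close> of case (iii), they say that
  \<open>u\<^sub>n' = u\<^sub>n (1 - u\<^sub>n) (v\<^sub>n\<^sub>+\<^sub>1 - v\<^sub>n)\<close> and \<open>v\<^sub>n' = v\<^sub>n (1 - v\<^sub>n) (u\<^sub>n - u\<^sub>n\<^sub>-\<^sub>1)\<close>.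
  For \<open>n = 0\<close>, \<open>v\<^sub>0 = 0\<close> and \<open>u\<^sub>0 = f'/f\<close> solves the Riccati equation equivalent to the Laguerre equation.
  If \<open>(u\<^sub>n, v\<^sub>n)\<close> solves the system, then the Toda equation for \<open>u\<^sub>n\<close> expresses \<open>v\<^sub>n\<^sub>+\<^sub>1\<close> through \<open>u\<^sub>n\<close> and
  \<open>v\<^sub>n\<close>, and differentiation gives the system for \<open>(u\<^sub>n, 1 - v\<^sub>n\<^sub>+\<^sub>1)\<close>, which is case (ii); the Toda equation
  for \<open>v\<^sub>n\<^sub>+\<^sub>1\<close> leads in the same way to \<open>(u\<^sub>n\<^sub>+\<^sub>1, v\<^sub>n\<^sub>+\<^sub>1)\<close>. Cases (i) and (iv) arise from (iii) by the reflections
  \<open>\<kappa>\<^sub>1 \<mapsto> -\<kappa>\<^sub>1\<close> and \<open>\<kappa>\<^sub>3 \<mapsto> -\<kappa>\<^sub>3\<close>, which change only \<open>v\<close>. Everything is first shown away from a finite set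
  and then extended by continuity.\<close>

section \<open>Determinant identities\<close>

lemma det_laplace_single_column:
  fixes A :: "'a::comm_ring_1 mat"
  assumes A: "A \<in> carrier_mat n n" and k: "k < n" and j: "j < n"
    and zero: "\<And>i. i < n \<Longrightarrow> i \<noteq> k \<Longrightarrow> A $$ (i, j) = 0"
  shows "Determinant.det A = A $$ (k, j) * cofactor A k j"
proof -
  have "Determinant.det A = (\<Sum>i<n. A $$ (i, j) * cofactor A i j)"
    by (rule laplace_expansion_column[OF A j])
  also have "\<dots> = (\<Sum>i\<in>{k}. A $$ (i, j) * cofactor A i j)"
    by (rule sum.mono_neutral_right) (use k zero in auto)
  finally show ?thesis by simp
qed

text \<open>This is right multiplication by the bidiagonal matrix \<open>U\<close> with ones on its
  diagonal. Every column loses a multiple of the original preceding column, not of the reduced one,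
  and the factor \<open>d\<close> may vary with the column, as \<open>det_ffact_nonzero\<close>
  requires in the version for rows.\<close>

lemma det_subtract_previous_columns:
  fixes F :: "nat \<Rightarrow> nat \<Rightarrow> 'a::comm_ring_1"
  shows "Determinant.det (Matrix.mat n n (\<lambda>(i, j). if j = 0 then F i 0 else F i j - d j * F i (j - 1)))
       = Determinant.det (Matrix.mat n n (\<lambda>(i, j). F i j))" (is "Determinant.det ?L = Determinant.det ?M")
proof -
  define U where "U = Matrix.mat n n (\<lambda>(i, j). if i = j then 1 else if j = Suc i then - d j else 0 :: 'a)"
  have U: "U \<in> carrier_mat n n" by (simp add: U_def)
  have "?L = ?M * U"
  proof (rule eq_matI)
    fix i j assume "i < dim_row (?M * U)" "j < dim_col (?M * U)"
    hence i: "i < n" and j: "j < n" by (auto simp: U_def)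
    have "(?M * U) $$ (i, j) = (\<Sum>k = 0..<n. F i k * (if k = j then 1 else if j = Suc k then - d j else 0))"
      using i j by (simp add: U_def scalar_prod_def cong: if_cong)
    also have "\<dots> = (\<Sum>k\<in>{j, j - 1}. F i k * (if k = j then 1 else if j = Suc k then - d j else 0))"
      by (rule sum.mono_neutral_right) (use j in auto)
    also have "\<dots> = ?L $$ (i, j)"
      using i j by (cases j) auto
    finally show "?L $$ (i, j) = (?M * U) $$ (i, j)" ..
  qed (auto simp: U_def)
  moreover have "Determinant.det U = 1"
  proof -
    have "upper_triangular U" by (auto simp: U_def)
    then have "Determinant.det U = prod_list (diag_mat U)"
      using U by (rule det_upper_triangular)
    also have "diag_mat U = map (\<lambda>_. 1) [0..<n]"
      by (auto simp: diag_mat_def U_def)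
    also have "prod_list \<dots> = 1" by (induction n) auto
    finally show ?thesis .
  qed
  ultimately show ?thesis
    using det_mult[of ?M n U] U by simp
qed

lemma det_mat_transpose:
  "Determinant.det (Matrix.mat n n (\<lambda>(i, j). F j i)) = Determinant.det (Matrix.mat n n (\<lambda>(i, j). F i j))"
proof -
  have "Matrix.mat n n (\<lambda>(i, j). F j i) = transpose_mat (Matrix.mat n n (\<lambda>(i, j). F i j))"
    by (rule eq_matI) auto
  then show ?thesis using det_transpose[of "Matrix.mat n n (\<lambda>(i, j). F i j)" n] by simp
qed

lemma det_subtract_previous_rows:
  fixes F :: "nat \<Rightarrow> nat \<Rightarrow> 'a::comm_ring_1"
  shows "Determinant.det (Matrix.mat n n (\<lambda>(i, j). if i = 0 then F 0 j else F i j - d i * F (i - 1) j))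
       = Determinant.det (Matrix.mat n n (\<lambda>(i, j). F i j))"
  using det_subtract_previous_columns[of n "\<lambda>i j. F j i" d]
    det_mat_transpose[of n "\<lambda>i j. if i = 0 then F 0 j else F i j - d i * F (i - 1) j"]
    det_mat_transpose[of n F]
  by simp

text \<open>Multiplying \<open>A\<close> by the identity with its first and last columns replaced by those of the
  adjugate clears these two columns of \<open>A\<close> up to \<open>det A\<close> on the diagonal.\<close>

lemma desnanot_jacobi:
  fixes F :: "nat \<Rightarrow> nat \<Rightarrow> 'a::idom"
  defines "D \<equiv> \<lambda>n F. Determinant.det (Matrix.mat n n (\<lambda>(i, j). F i j :: 'a))"
  assumes nz: "D (Suc (Suc n)) F \<noteq> 0"
  shows "D (Suc (Suc n)) F * D n (\<lambda>i j. F (Suc i) (Suc j)) =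
    D (Suc n) F * D (Suc n) (\<lambda>i j. F (Suc i) (Suc j)) -
    D (Suc n) (\<lambda>i j. F (Suc i) j) * D (Suc n) (\<lambda>i j. F i (Suc j))"
proof -
  let ?l = "Suc n" and ?N = "Suc (Suc n)"
  define A where "A = Matrix.mat ?N ?N (\<lambda>(i, j). F i j)"
  define d where "d = Determinant.det A"
  have A: "A \<in> carrier_mat ?N ?N" by (simp add: A_def)
  \<comment> \<open>\<open>p\<close> and \<open>q\<close> are the first and last columns of the
    adjugate; up to sign, their end entries are the four minors of size \<open>Suc n\<close> in the
    identity.\<close>
  define p where "p i = cofactor A 0 i" for i
  define q where "q i = cofactor A ?l i" for i
  have p0: "p 0 = D ?l (\<lambda>i j. F (Suc i) (Suc j))"
    unfolding p_def cofactor_def mat_delete_def D_def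
    by (auto simp: A_def intro!: arg_cong[of _ _ Determinant.det] eq_matI)
  have pl: "p ?l = (-1) ^ ?l * D ?l (\<lambda>i j. F (Suc i) j)"
    unfolding p_def cofactor_def mat_delete_def D_def
    by (auto simp: A_def intro!: arg_cong[of _ _ Determinant.det] eq_matI)
  have q0: "q 0 = (-1) ^ ?l * D ?l (\<lambda>i j. F i (Suc j))"
    unfolding q_def cofactor_def mat_delete_def D_def
    by (auto simp: A_def intro!: arg_cong[of _ _ Determinant.det] eq_matI)
  have ql: "q ?l = D ?l F"
    unfolding q_def cofactor_def mat_delete_def D_def
    by (auto simp: A_def intro!: arg_cong[of _ _ Determinant.det] eq_matI)
  define B where "B = Matrix.mat ?N ?N
    (\<lambda>(i, j). if j = 0 then p i else if j = ?l then q i else if i = j then 1 else 0)"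
  define C where "C = Matrix.mat ?N ?N
    (\<lambda>(i, j). if j = 0 then (if i = 0 then d else 0) else if j = ?l then (if i = ?l then d else 0) else F i j)"
  have B: "B \<in> carrier_mat ?N ?N" and C: "C \<in> carrier_mat ?N ?N" by (simp_all add: B_def C_def)
  have adj: "A * adj_mat A = d \<cdot>\<^sub>m 1\<^sub>m ?N" unfolding d_def by (rule adj_mat(2)[OF A])
  have adjc: "(\<Sum>k = 0..<?N. F i k * cofactor A j k) = (if i = j then d else 0)"
    if "i < ?N" "j < ?N" for i j
  proof -
    have "(A * adj_mat A) $$ (i, j) = (\<Sum>k = 0..<?N. F i k * cofactor A j k)"
      using that A by (simp add: adj_mat_def scalar_prod_def A_def del: sum.op_ivl_Suc)
    then show ?thesis using that by (simp add: adj del: sum.op_ivl_Suc split: if_splits)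
  qed
  have "A * B = C"
  proof (rule eq_matI)
    fix i j assume "i < dim_row C" "j < dim_col C"
    hence i: "i < ?N" and j: "j < ?N" by (auto simp: C_def)
    have "(A * B) $$ (i, j) = (\<Sum>k = 0..<?N. F i k *
        (if j = 0 then p k else if j = ?l then q k else if k = j then 1 else 0))"
      using i j by (simp add: A_def B_def scalar_prod_def cong: if_cong del: sum.op_ivl_Suc)
    also have "\<dots> = C $$ (i, j)"
    proof -
      consider "j = 0" | "j = ?l" | "j \<noteq> 0" "j \<noteq> ?l" by blast
      then show ?thesis
      proof cases
        case 1 then show ?thesis using adjc[OF i, of 0] i by (simp add: p_def C_def del: sum.op_ivl_Suc)
      next
        case 2 then show ?thesis using adjc[OF i, of ?l] i by (simp add: q_def C_def del: sum.op_ivl_Suc)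
      next
        case 3
        have "(\<Sum>k = 0..<?N. F i k * (if k = j then 1 else 0)) = (\<Sum>k\<in>{j}. F i k)"
          by (rule sum.mono_neutral_cong_right) (use j in auto)
        then show ?thesis using 3 i j by (simp add: C_def del: sum.op_ivl_Suc)
      qed
    qed
    finally show "(A * B) $$ (i, j) = C $$ (i, j)" .
  qed (auto simp: A_def B_def C_def)
  then have "d * Determinant.det B = Determinant.det C"
    using det_mult[OF A B] by (simp add: d_def)
  \<comment> \<open>Apart from its first and last columns \<open>B\<close> is the identity, so only
    its four corner entries contribute.\<close>
  moreover have "Determinant.det B = p 0 * q ?l - q 0 * p ?l"
  proof -
    have "Determinant.det B = (\<Sum>j<?N. B $$ (0, j) * cofactor B 0 j)"
      by (rule laplace_expansion_row[OF B]) simp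
    also have "\<dots> = (\<Sum>j\<in>{0, ?l}. B $$ (0, j) * cofactor B 0 j)"
      by (rule sum.mono_neutral_right) (auto simp: B_def)
    also have "\<dots> = p 0 * cofactor B 0 0 + q 0 * cofactor B 0 ?l"
      by (simp add: B_def)
    also have "cofactor B 0 0 = q ?l"
    proof -
      define M where "M = mat_delete B 0 0"
      have M: "M \<in> carrier_mat ?l ?l" by (simp add: M_def mat_delete_def B_def)
      have M': "M = Matrix.mat ?l ?l (\<lambda>(i, j). if j = n then q (Suc i) else if i = j then 1 else 0)"
        by (rule eq_matI) (auto simp: M_def mat_delete_def B_def)
      have "Determinant.det M = prod_list (diag_mat M)"
        by (rule det_upper_triangular[OF _ M]) (auto simp: M')
      also have "diag_mat M = map (\<lambda>i. 1) [0..<n] @ [q ?l]"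
        by (auto simp: diag_mat_def M')
      also have "prod_list \<dots> = q ?l"
      proof -
        have "prod_list (map (\<lambda>i. 1 :: 'a) [0..<n]) = 1" by (induction n) auto
        then show ?thesis by simp
      qed
      finally show ?thesis by (simp add: cofactor_def M_def)
    qed
    also have "cofactor B 0 ?l = - p ?l"
    proof -
      define M where "M = mat_delete B 0 ?l"
      have M: "M \<in> carrier_mat ?l ?l" by (simp add: M_def mat_delete_def B_def)
      have M': "M = Matrix.mat ?l ?l (\<lambda>(i, j). if j = 0 then p (Suc i) else if Suc i = j then 1 else 0)"
        by (rule eq_matI) (auto simp: M_def mat_delete_def B_def)
      have "Determinant.det M = (\<Sum>j<?l. M $$ (n, j) * cofactor M n j)"
        by (rule laplace_expansion_row[OF M]) simp
      also have "\<dots> = (\<Sum>j\<in>{0}. M $$ (n, j) * cofactor M n j)"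
        by (rule sum.mono_neutral_right) (auto simp: M')
      also have "\<dots> = p ?l * cofactor M n 0" by (simp add: M')
      also have "cofactor M n 0 = (-1) ^ n"
      proof -
        have "mat_delete M n 0 = 1\<^sub>m n" by (rule eq_matI) (auto simp: M' mat_delete_def)
        then show ?thesis by (simp add: cofactor_def)
      qed
      finally have "Determinant.det M = p ?l * (-1) ^ n" .
      then show ?thesis by (simp add: cofactor_def M_def[symmetric] mult.left_commute)
    qed
    finally show ?thesis by simp
  qed
  moreover have "Determinant.det C = d * (d * D n (\<lambda>i j. F (Suc i) (Suc j)))"
  proof -
    define M where "M = mat_delete C 0 0"
    have M: "M \<in> carrier_mat ?l ?l" by (simp add: M_def mat_delete_def C_def)
    have M': "M = Matrix.mat ?l ?l (\<lambda>(i, j). if j = n then (if i = n then d else 0) else F (Suc i) (Suc j))"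
      by (rule eq_matI) (auto simp: M_def mat_delete_def C_def)
    have "Determinant.det C = C $$ (0, 0) * cofactor C 0 0"
      by (rule det_laplace_single_column[OF C]) (auto simp: C_def)
    also have "\<dots> = d * Determinant.det M"
      by (simp add: C_def cofactor_def M_def)
    also have "Determinant.det M = M $$ (n, n) * cofactor M n n"
      by (rule det_laplace_single_column[OF M]) (auto simp: M')
    also have "\<dots> = d * Determinant.det (mat_delete M n n)"
      by (simp add: M' cofactor_def)
    also have "mat_delete M n n = Matrix.mat n n (\<lambda>(i, j). F (Suc i) (Suc j))"
      by (rule eq_matI) (auto simp: M' mat_delete_def)
    finally show ?thesis by (simp add: D_def)
  qed
  ultimately have "d * (p 0 * q ?l - q 0 * p ?l) = d * (d * D n (\<lambda>i j. F (Suc i) (Suc j)))" by simp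
  moreover have d: "d = D ?N F" by (simp add: d_def A_def D_def)
  \<comment> \<open>Cancelling one factor \<open>d\<close> is where the hypothesis \<open>nz\<close>
    enters.\<close>
  ultimately have "d * D n (\<lambda>i j. F (Suc i) (Suc j)) = p 0 * q ?l - q 0 * p ?l"
    using nz by simp
  moreover have "q 0 * p ?l = D ?l (\<lambda>i j. F (Suc i) j) * D ?l (\<lambda>i j. F i (Suc j))"
  proof -
    have "(-1) ^ ?l * (-1) ^ ?l = (1 :: 'a)" by (simp flip: power_add)
    moreover have "e * x * (e * y) = e * e * (y * x)" for e x y :: 'a by (simp only: ac_simps)
    ultimately show ?thesis unfolding q0 pl by (simp only: mult_1)
  qed
  ultimately show ?thesis by (simp add: d p0 ql mult.commute)
qed

section \<open>Hankel determinants of derivatives\<close>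

text \<open>The Wronskian of \<open>f\<close> and its first \<open>n - 1\<close> derivatives, in
  Hankel form; generalised Laguerre polynomials are the case where \<open>f\<close> is a Laguerre
  polynomial.\<close>

definition hankel_wronskian :: "nat \<Rightarrow> 'a::field_char_0 poly \<Rightarrow> 'a poly" where
  "hankel_wronskian n f = Determinant.det (Matrix.mat n n (\<lambda>(j, k). (pderiv ^^ (j + k)) f))"

text \<open>The operator \<open>D - c\<close>, which multiplies a weight
  \<open>e^(z x) rho(x)\<close> by \<open>x - c\<close>. Keeping \<open>c\<close> general lets one
  proof cover both values 0 and 1 that occur for the chain.\<close>

definition shifted_pderiv :: "'a::field_char_0 \<Rightarrow> 'a poly \<Rightarrow> 'a poly" where
  "shifted_pderiv c f = pderiv f - Polynomial.smult c f"

lemma shifted_pderiv_0 [simp]: "shifted_pderiv 0 f = pderiv f"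
  by (simp add: shifted_pderiv_def)

lemma pderiv_shifted_pderiv: "pderiv (shifted_pderiv c f) = shifted_pderiv c (pderiv f)"
  by (simp add: shifted_pderiv_def pderiv_diff pderiv_smult)

lemma shifted_pderiv_commute:
  "shifted_pderiv c (shifted_pderiv d f) = shifted_pderiv d (shifted_pderiv c f)"
  by (simp add: shifted_pderiv_def pderiv_diff pderiv_smult smult_diff_right algebra_simps)

text \<open>\<open>D - c\<close> commutes with \<open>D\<close>. In a Hankel matrix the formula
  means that \<open>c\<close> times the preceding row or column is subtracted.\<close>

lemma higher_pderiv_shifted_pderiv:
  "(pderiv ^^ n) (shifted_pderiv c f) = (pderiv ^^ Suc n) f - Polynomial.smult c ((pderiv ^^ n) f)"
  by (induction n) (simp_all add: shifted_pderiv_def pderiv_diff pderiv_smult)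

lemma hankel_wronskian_0 [simp]: "hankel_wronskian 0 f = 1"
  by (simp add: hankel_wronskian_def)

lemma hankel_wronskian_1 [simp]: "hankel_wronskian (Suc 0) f = f"
  by (simp add: hankel_wronskian_def det_single)

lemma hankel_wronskian_uminus: "hankel_wronskian n (- f) = (-1) ^ n * hankel_wronskian n f"
proof -
  have "(pderiv ^^ k) (- f) = - (pderiv ^^ k) f" for k
    by (induction k) (simp_all add: pderiv_minus)
  then have "Matrix.mat n n (\<lambda>(j, k). (pderiv ^^ (j + k)) (- f)) =
      (-1) \<cdot>\<^sub>m Matrix.mat n n (\<lambda>(j, k). (pderiv ^^ (j + k)) f)"
    by (intro eq_matI) auto
  then show ?thesis by (simp add: hankel_wronskian_def)
qed

lemma degree_shifted_pderiv_ge: "degree f - 1 \<le> degree (shifted_pderiv c f)"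
proof (cases "c = 0 \<or> degree f = 0")
  case True
  then show ?thesis by (auto simp: degree_pderiv)
next
  case False
  then have "coeff (shifted_pderiv c f) (degree f) \<noteq> 0"
    by (auto simp: shifted_pderiv_def coeff_pderiv coeff_eq_0)
  then show ?thesis using le_degree by fastforce
qed

lemma degree_shifted_pderiv: "c \<noteq> 0 \<Longrightarrow> degree (shifted_pderiv c f) = degree f"
proof (cases "degree f = 0")
  case True
  then show "c \<noteq> 0 \<Longrightarrow> ?thesis" by (elim degree_eq_zeroE) (simp add: shifted_pderiv_def)
next
  case False
  assume c: "c \<noteq> 0"
  have "degree (- Polynomial.smult c f + pderiv f) = degree (- Polynomial.smult c f)"
    by (rule degree_add_eq_left) (use False c in \<open>simp add: degree_pderiv\<close>)
  then show ?thesis using c by (simp add: shifted_pderiv_def)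
qed

lemma shifted_pderiv_nonzero:
  assumes "f \<noteq> 0" "c \<noteq> 0 \<or> degree f \<noteq> 0"
  shows "shifted_pderiv c f \<noteq> 0"
proof (cases "c = 0")
  case True
  then show ?thesis using assms by (auto simp: pderiv_eq_0_iff)
next
  case False
  then have "coeff (shifted_pderiv c f) (degree f) \<noteq> 0"
    using assms by (simp add: shifted_pderiv_def coeff_pderiv coeff_eq_0)
  then show ?thesis by auto
qed

lemma higher_pderiv_eq_0:
  fixes f :: "'a::field_char_0 poly"
  shows "degree f < k \<Longrightarrow> (pderiv ^^ k) f = 0"
proof (induction k arbitrary: f)
  case (Suc k)
  show ?case
  proof (cases "degree f = 0")
    case True
    then have "pderiv f = 0" by (simp add: pderiv_eq_0_iff)
    then show ?thesis by (simp add: funpow_Suc_right del: funpow.simps)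
  next
    case False
    then have "(pderiv ^^ k) (pderiv f) = 0" using Suc by (intro Suc.IH) (simp add: degree_pderiv)
    then show ?thesis by (simp add: funpow_Suc_right del: funpow.simps)
  qed
qed simp

text \<open>All entries of the last column are derivatives of order at least \<open>k\<close>. This
  settles the boundary case of \<open>hankel_wronskian_toda\<close> in which a degree is too
  small.\<close>

lemma hankel_wronskian_eq_0:
  assumes "(pderiv ^^ k) f = 0"
  shows "hankel_wronskian (Suc k) f = 0"
proof -
  let ?A = "Matrix.mat (Suc k) (Suc k) (\<lambda>(j, k). (pderiv ^^ (j + k)) f)"
  have "(pderiv ^^ (j + k)) f = 0" for j
    unfolding funpow_add o_apply assms by (induction j) simp_all
  then have "Determinant.det ?A = ?A $$ (0, k) * cofactor ?A 0 k" and "?A $$ (0, k) = 0"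
    by (intro det_laplace_single_column[where n = "Suc k"]) (auto simp: assms)
  then show ?thesis by (simp add: hankel_wronskian_def)
qed

section \<open>Nonvanishing of the Hankel determinants\<close>

text \<open>The falling factorial \<open>N (N - 1) ... (N - k + 1)\<close>. The differences are
  taken in the field, so for \<open>k > N\<close> one factor is zero and no truncated subtraction
  occurs.\<close>

definition ffact :: "nat \<Rightarrow> nat \<Rightarrow> 'a::field_char_0" where
  "ffact k N = (\<Prod>i<k. of_nat N - of_nat i)"

lemma ffact_0 [simp]: "ffact 0 N = 1"
  by (simp add: ffact_def)

lemma ffact_Suc: "ffact (Suc k) N = ffact k N * (of_nat N - of_nat k)"
  by (simp add: ffact_def)

lemma ffact_Suc_Suc: "ffact (Suc k) (Suc N) = of_nat (Suc N) * ffact k N"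
proof -
  have "ffact (Suc k) (Suc N) = (of_nat (Suc N) :: 'a) * (\<Prod>i<k. of_nat (Suc N) - of_nat (Suc i))"
    unfolding ffact_def by (subst prod.lessThan_Suc_shift) simp
  then show ?thesis by (simp add: ffact_def)
qed

lemma det_mat_leibniz:
  "Determinant.det (Matrix.mat n n F) =
    (\<Sum>p | p permutes {0..<n}. signof p * (\<Prod>i = 0..<n. F (i, p i)))"
proof -
  have "p i < n" if "p permutes {0..<n}" "i < n" for p i
    using permutes_in_image[OF that(1), of i] that(2) by simp
  then have "(\<Prod>i = 0..<n. Matrix.mat n n F $$ (i, p i)) = (\<Prod>i = 0..<n. F (i, p i))"
    if "p permutes {0..<n}" for p
    using that by (intro prod.cong) auto
  then show ?thesis by (simp add: Determinant.det_def)
qed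

lemma det_scale_rows_columns:
  fixes F :: "nat \<Rightarrow> nat \<Rightarrow> 'a::comm_ring_1"
  shows "Determinant.det (Matrix.mat n n (\<lambda>(i, j). a i * b j * F i j)) =
    prod a {0..<n} * prod b {0..<n} * Determinant.det (Matrix.mat n n (\<lambda>(i, j). F i j))"
proof -
  have "signof p * (\<Prod>i = 0..<n. a i * b (p i) * F i (p i)) =
      prod a {0..<n} * prod b {0..<n} * (signof p * (\<Prod>i = 0..<n. F i (p i)))"
    if "p permutes {0..<n}" for p
  proof -
    have "(\<Prod>i = 0..<n. b (p i)) = prod b {0..<n}"
      using prod.permute[OF that, of b] by (simp add: o_def)
    then show ?thesis by (simp add: prod.distrib mult_ac)
  qed
  then show ?thesis
    unfolding det_mat_leibniz by (simp add: sum_distrib_left)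
qed

lemma coeff_mult_degree_bounds:
  assumes "degree p \<le> a" "degree q \<le> b"
  shows "coeff (p * q) (a + b) = coeff p a * coeff q b"
proof -
  have "coeff (p * q) (a + b) = (\<Sum>i\<le>a + b. coeff p i * coeff q (a + b - i))" by (rule coeff_mult)
  also have "\<dots> = (\<Sum>i\<in>{a}. coeff p i * coeff q (a + b - i))"
  proof (rule sum.mono_neutral_right)
    show "\<forall>i\<in>{..a + b} - {a}. coeff p i * coeff q (a + b - i) = 0"
    proof
      fix i assume "i \<in> {..a + b} - {a}"
      then consider "i < a" "i \<le> a + b" | "i > a" by fastforce
      then show "coeff p i * coeff q (a + b - i) = 0"
        by cases (use assms in \<open>simp_all add: coeff_eq_0\<close>)
    qed
  qed auto
  finally show ?thesis by simp
qed

lemma coeff_prod_degree_bounds: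
  fixes p :: "nat \<Rightarrow> 'a::comm_ring_1 poly"
  assumes "\<And>i. i < n \<Longrightarrow> degree (p i) \<le> d"
  shows "degree (\<Prod>i = 0..<n. p i) \<le> n * d \<and>
    coeff (\<Prod>i = 0..<n. p i) (n * d) = (\<Prod>i = 0..<n. coeff (p i) d)"
  using assms
proof (induction n)
  case (Suc n)
  let ?P = "\<Prod>i = 0..<n. p i"
  have IH: "degree ?P \<le> n * d" "coeff ?P (n * d) = (\<Prod>i = 0..<n. coeff (p i) d)"
    using Suc.IH Suc.prems by auto
  have "degree (?P * p n) \<le> n * d + d"
    using degree_mult_le[of ?P "p n"] IH(1) Suc.prems[of n] by linarith
  moreover have "coeff (?P * p n) (n * d + d) = coeff ?P (n * d) * coeff (p n) d"
    by (rule coeff_mult_degree_bounds) (use IH Suc.prems in auto)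
  ultimately show ?case using IH(2) by (simp add: add.commute)
qed simp

text \<open>Every Leibniz product has degree at most \<open>n * d\<close>, and its coefficient there
  is the product of the coefficients at \<open>d\<close>, whether or not these vanish.\<close>

lemma coeff_det_degree_bounds:
  fixes F :: "nat \<Rightarrow> nat \<Rightarrow> 'a::comm_ring_1 poly"
  assumes "\<And>i j. i < n \<Longrightarrow> j < n \<Longrightarrow> degree (F i j) \<le> d"
  shows "coeff (Determinant.det (Matrix.mat n n (\<lambda>(i, j). F i j))) (n * d) =
    Determinant.det (Matrix.mat n n (\<lambda>(i, j). coeff (F i j) d))"
proof -
  have lt: "p i < n" if "p permutes {0..<n}" "i < n" for p i
    using permutes_in_image[OF that(1), of i] that(2) by simp
  have "coeff (signof p * (\<Prod>i = 0..<n. F i (p i))) (n * d) =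
      signof p * (\<Prod>i = 0..<n. coeff (F i (p i)) d)" if "p permutes {0..<n}" for p
    using coeff_prod_degree_bounds[of n "\<lambda>i. F i (p i)" d] assms lt[OF that]
    by (auto simp: sign_def)
  then show ?thesis unfolding det_mat_leibniz by (simp add: coeff_sum)
qed

text \<open>Subtracting \<open>N - (j - 1)\<close> times row \<open>j - 1\<close> from row
  \<open>j\<close> leaves the entries \<open>- k * ffact (j - 1 + k) N\<close>. This clears the
  first column below the corner; after factors are taken out of the columns, the same determinant
  with \<open>n\<close> and \<open>N\<close> lowered by one remains.\<close>

lemma det_ffact_nonzero:
  "n \<le> N + 1 \<Longrightarrow>
    Determinant.det (Matrix.mat n n (\<lambda>(j, k). ffact (j + k) N :: 'a::field_char_0)) \<noteq> 0"
proof (induction n arbitrary: N)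
  case (Suc n)
  show ?case
  proof (cases "n = 0")
    case True
    then show ?thesis by (simp add: det_single)
  next
    case False
    with Suc.prems obtain M where N: "N = Suc M" by (cases N) auto
    define A where "A = Matrix.mat (Suc n) (Suc n) (\<lambda>(j, k). if j = 0 then ffact (0 + k) N else
      ffact (j + k) N - (of_nat N - of_nat (j - 1)) * ffact (j - 1 + k) N :: 'a)"
    have A: "A \<in> carrier_mat (Suc n) (Suc n)" by (simp add: A_def)
    have entry: "A $$ (j, k) = - of_nat k * ffact (j - 1 + k) N"
      if "j \<noteq> 0" "j < Suc n" "k < Suc n" for j k
      using that by (cases j) (auto simp: A_def ffact_Suc algebra_simps)
    have "Determinant.det (Matrix.mat (Suc n) (Suc n) (\<lambda>(j, k). ffact (j + k) N :: 'a)) = Determinant.det A"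
      unfolding A_def by (rule det_subtract_previous_rows[symmetric])
    also have "\<dots> = A $$ (0, 0) * cofactor A 0 0"
      by (rule det_laplace_single_column[OF A]) (auto simp: entry)
    also have "\<dots> = Determinant.det (mat_delete A 0 0)"
      by (simp add: A_def cofactor_def)
    also have "mat_delete A 0 0 =
        Matrix.mat n n (\<lambda>(j, k). 1 * (- of_nat (Suc k) * of_nat N) * ffact (j + k) M)"
      by (rule eq_matI) (auto simp: mat_delete_def entry N ffact_Suc_Suc dim_row_mat A_def[THEN arg_cong, of dim_row] A_def[THEN arg_cong, of dim_col] simp del: of_nat_Suc)
    finally have "Determinant.det (Matrix.mat (Suc n) (Suc n) (\<lambda>(j, k). ffact (j + k) N :: 'a)) =
        Determinant.det (Matrix.mat n n (\<lambda>(j, k). 1 * (- of_nat (Suc k) * of_nat N) * ffact (j + k) M :: 'a))" .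
    also have "\<dots> = (\<Prod>k = 0..<n. - of_nat (Suc k) * of_nat N) *
        Determinant.det (Matrix.mat n n (\<lambda>(j, k). ffact (j + k) M))"
      by (subst det_scale_rows_columns) simp
    finally show ?thesis using Suc.IH[of M] Suc.prems N by (simp del: of_nat_Suc)
  qed
qed simp

text \<open>The factor \<open>z^k\<close> undoes the loss of degree under \<open>k\<close>
  derivatives. For \<open>i < k\<close> both coefficients vanish because \<open>ffact k i\<close>
  does.\<close>

lemma coeff_higher_pderiv:
  fixes f :: "'a::field_char_0 poly"
  shows "degree (monom 1 k * (pderiv ^^ k) f) \<le> degree f \<and>
    coeff (monom 1 k * (pderiv ^^ k) f) i = ffact k i * coeff f i"
proof -
  have c: "coeff (monom 1 k * (pderiv ^^ k) f) i = ffact k i * coeff f i" for i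
  proof (induction k arbitrary: i)
    case (Suc k)
    show ?case
    proof (cases i)
      case 0
      then show ?thesis by (auto simp: coeff_monom_mult ffact_def)
    next
      case (Suc i')
      have "coeff (monom 1 (Suc k) * (pderiv ^^ Suc k) f) (Suc i') =
          coeff (monom 1 k * pderiv ((pderiv ^^ k) f)) i'"
        by (simp add: coeff_monom_mult)
      also have "\<dots> = (of_nat (Suc i') - of_nat k) * coeff (monom 1 k * (pderiv ^^ k) f) (Suc i')"
      proof -
        consider "Suc i' < k" | "k = Suc i'" | "k \<le> i'" by linarith
        then show ?thesis
          by cases (simp_all add: coeff_monom_mult coeff_pderiv Suc_diff_le of_nat_diff)
      qed
      finally show ?thesis using Suc.IH[of "Suc i'"] Suc by (simp add: ffact_Suc)
    qed
  qed simp
  then show ?thesis by (auto intro!: degree_le simp: coeff_eq_0)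
qed

text \<open>Scaling row \<open>j\<close> by \<open>z^j\<close> and column \<open>k\<close> by
  \<open>z^k\<close> brings all entries to degree at most \<open>degree f\<close>. The coefficient
  of the determinant at \<open>n * degree f\<close> is then a power of the leading coefficient of
  \<open>f\<close> times the determinant in \<open>det_ffact_nonzero\<close>, whence the bound on
  \<open>n\<close>.\<close>

lemma hankel_wronskian_nonzero:
  fixes f :: "'a::field_char_0 poly"
  assumes "f \<noteq> 0" "n \<le> degree f + 1"
  shows "hankel_wronskian n f \<noteq> 0"
proof
  assume "hankel_wronskian n f = 0"
  then have "Determinant.det (Matrix.mat n n (\<lambda>(j, k).
      monom 1 j * monom 1 k * (pderiv ^^ (j + k)) f)) = 0"
    by (subst det_scale_rows_columns) (simp add: hankel_wronskian_def)
  then have "0 = coeff (Determinant.det (Matrix.mat n n (\<lambda>(j, k).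
      monom 1 (j + k) * (pderiv ^^ (j + k)) f))) (n * degree f)"
    by (simp add: mult_monom)
  also have "\<dots> = Determinant.det (Matrix.mat n n (\<lambda>(j, k).
      coeff (monom 1 (j + k) * (pderiv ^^ (j + k)) f) (degree f)))"
    by (rule coeff_det_degree_bounds) (use coeff_higher_pderiv in blast)
  also have "\<dots> = Determinant.det (lead_coeff f \<cdot>\<^sub>m Matrix.mat n n (\<lambda>(j, k). ffact (j + k) (degree f)))"
    by (intro arg_cong[of _ _ Determinant.det] eq_matI) (simp_all add: coeff_higher_pderiv mult.commute)
  finally show False using assms det_ffact_nonzero[of n "degree f", where 'a = 'a] by simp
qed

section \<open>Bilinear and differential relations for Hankel determinants\<close>

text \<open>The Hankel matrix of \<open>f\<close> is reduced by columns with \<open>d\<close> and by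
  rows with \<open>c\<close>, leaving the first column and row alone. Leading determinants do not
  change, while dropping the first row, the first column or both gives Hankel determinants with
  \<open>D - c\<close>, \<open>D - d\<close> or both applied.\<close>

lemma hankel_wronskian_desnanot_jacobi:
  fixes f :: "'a::field_char_0 poly"
  assumes "f \<noteq> 0" "n < degree f"
  shows "hankel_wronskian (Suc (Suc n)) f * hankel_wronskian n (shifted_pderiv c (shifted_pderiv d f)) =
    hankel_wronskian (Suc n) f * hankel_wronskian (Suc n) (shifted_pderiv c (shifted_pderiv d f)) -
    hankel_wronskian (Suc n) (shifted_pderiv c f) * hankel_wronskian (Suc n) (shifted_pderiv d f)"
proof -
  define a where "a k = (pderiv ^^ k) f" for k
  define b where "b e k = (pderiv ^^ k) (shifted_pderiv e f)" for e k
  define r where "r k = (pderiv ^^ k) (shifted_pderiv c (shifted_pderiv d f))" for k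
  have b: "b e k = a (Suc k) - [:e:] * a k" for e k
    by (simp add: a_def b_def higher_pderiv_shifted_pderiv)
  have r: "r k = b c (Suc k) - [:d:] * b c k" for k
    unfolding r_def b_def by (subst shifted_pderiv_commute) (simp add: higher_pderiv_shifted_pderiv)
  have r': "r k = b d (Suc k) - [:c:] * b d k" for k
    unfolding r_def b_def by (simp add: higher_pderiv_shifted_pderiv)
  let ?D = "\<lambda>n F. Determinant.det (Matrix.mat n n (\<lambda>(i, j). F i j))"
  define G where "G i j = (if j = 0 then a i else b d (i + (j - 1)))" for i j
  define F where "F i j = (if i = 0 then G 0 j else G i j - [:c:] * G (i - 1) j)" for i j
  have G_det: "?D m G = ?D m (\<lambda>i j. a (i + j))" for m
  proof -
    have "G = (\<lambda>i j. if j = 0 then a (i + 0) else a (i + j) - [:d:] * a (i + (j - 1)))"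
      unfolding G_def by (intro ext) (auto simp: b)
    then show ?thesis using det_subtract_previous_columns[of m "\<lambda>i j. a (i + j)" "\<lambda>_. [:d:]"] by simp
  qed
  have F_det: "?D m F = ?D m (\<lambda>i j. a (i + j))" for m
    using det_subtract_previous_rows[of m G "\<lambda>_. [:c:]"] unfolding G_det[symmetric] F_def by simp
  have F11: "?D m (\<lambda>i j. F (Suc i) (Suc j)) = ?D m (\<lambda>i j. r (i + j))" for m
    by (simp add: F_def G_def r')
  have F10: "?D m (\<lambda>i j. F (Suc i) j) = ?D m (\<lambda>i j. b c (i + j))" for m
  proof -
    have "(\<lambda>i j. F (Suc i) j) = (\<lambda>i j. if j = 0 then b c (i + 0) else b c (i + j) - [:d:] * b c (i + (j - 1)))"
      unfolding F_def G_def by (intro ext) (auto simp: b smult_diff_right algebra_simps)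
    then show ?thesis using det_subtract_previous_columns[of m "\<lambda>i j. b c (i + j)" "\<lambda>_. [:d:]"] by simp
  qed
  have F01: "?D m (\<lambda>i j. F i (Suc j)) = ?D m (\<lambda>i j. b d (i + j))" for m
  proof -
    have "(\<lambda>i j. F i (Suc j)) = (\<lambda>i j. if i = 0 then b d (0 + j) else b d (i + j) - [:c:] * b d ((i - 1) + j))"
      unfolding F_def G_def by (intro ext) auto
    then show ?thesis using det_subtract_previous_rows[of m "\<lambda>i j. b d (i + j)" "\<lambda>_. [:c:]"] by simp
  qed
  have H: "hankel_wronskian m f = ?D m (\<lambda>i j. a (i + j))"
    "hankel_wronskian m (shifted_pderiv e f) = ?D m (\<lambda>i j. b e (i + j))"
    "hankel_wronskian m (shifted_pderiv c (shifted_pderiv d f)) = ?D m (\<lambda>i j. r (i + j))" for m e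
    by (simp_all add: hankel_wronskian_def a_def b_def r_def)
  have "?D (Suc (Suc n)) F \<noteq> 0"
    using hankel_wronskian_nonzero[of f "Suc (Suc n)"] assms by (simp add: F_det H)
  from desnanot_jacobi[OF this] show ?thesis
    unfolding H F_det F11 F10 F01 .
qed

text \<open>The three-term relation comes from \<open>1 = x - (x - 1)\<close>. It is proved by induction from the
  Desnanot--Jacobi relations, together with two more three-term relations \<open>star\<close> and \<open>starstar\<close>.\<close>

lemma hankel_wronskian_mixed:
  fixes f :: "'a::field_char_0 poly"
  defines "tau \<equiv> \<lambda>i j n f. hankel_wronskian n ((shifted_pderiv 0 ^^ i) ((shifted_pderiv 1 ^^ j) f))"
  defines "r \<equiv> \<lambda>i j n f. if n = 0 then 0 else tau i j (n - 1) f"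
  assumes "f \<noteq> 0" "n < degree f"
  shows "tau 0 0 (Suc n) f * tau 1 1 n f = tau 0 1 n f * tau 1 0 (Suc n) f - tau 1 0 n f * tau 0 1 (Suc n) f
    \<and> tau 0 0 (Suc n) f * r 2 1 n f = tau 1 0 n f * tau 1 1 n f - tau 0 1 n f * tau 2 0 n f"
  using assms(3,4)
proof (induction n arbitrary: f)
  case 0
  show ?case
    by (simp add: tau_def r_def shifted_pderiv_def[of 1])
next
  case (Suc n)
  define g where "g = pderiv f"
  have g: "g \<noteq> 0" "n < degree g"
    using Suc.prems by (auto simp: g_def degree_pderiv pderiv_eq_0_iff)
  define h where "h = shifted_pderiv 1 f"
  have h: "h \<noteq> 0" "degree h = degree f"
    using Suc.prems by (auto simp: h_def degree_shifted_pderiv shifted_pderiv_nonzero)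
  \<comment> \<open>Replacing \<open>f\<close> by \<open>g\<close> raises the first index and
    replacing it by \<open>h\<close> the second, so relations for \<open>g\<close> and
    \<open>h\<close> become relations for \<open>f\<close>. In \<open>r\<close>, a determinant of
    size \<open>-1\<close> is read as zero.\<close>
  have sg: "tau i j m g = tau (Suc i) j m f" for i j m
  proof -
    have "(shifted_pderiv 1 ^^ j) (pderiv f) = pderiv ((shifted_pderiv 1 ^^ j) f)"
      by (induction j) (simp_all add: pderiv_shifted_pderiv)
    then show ?thesis unfolding tau_def g_def by (simp only: funpow_Suc_right o_apply shifted_pderiv_0)
  qed
  have sh: "tau i j m h = tau i (Suc j) m f" for i j m
    unfolding tau_def h_def by (simp only: funpow_Suc_right o_apply)
  have alpha: "tau 0 0 (Suc (Suc k)) e * tau 2 0 k e = tau 0 0 (Suc k) e * tau 2 0 (Suc k) e - tau 1 0 (Suc k) e * tau 1 0 (Suc k) e"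
    and gamma: "tau 0 0 (Suc (Suc k)) e * tau 1 1 k e = tau 0 0 (Suc k) e * tau 1 1 (Suc k) e - tau 1 0 (Suc k) e * tau 0 1 (Suc k) e"
    if "e \<noteq> 0" "k < degree e" for k e
    using hankel_wronskian_desnanot_jacobi[OF that, of 0 0]
      hankel_wronskian_desnanot_jacobi[OF that, of 0 1]
    by (simp_all add: tau_def numeral_2_eq_2)
  have nz: "tau i j k f \<noteq> 0" if "k + i \<le> degree f + 1" "i \<le> degree f" for i j k
  proof -
    have *: "(shifted_pderiv 1 ^^ j) f \<noteq> 0 \<and> degree ((shifted_pderiv 1 ^^ j) f) = degree f" for j
      by (induction j) (use Suc.prems in \<open>simp_all add: shifted_pderiv_nonzero degree_shifted_pderiv\<close>)
    have "(shifted_pderiv 0 ^^ i) ((shifted_pderiv 1 ^^ j) f) \<noteq> 0 \<and>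
        degree ((shifted_pderiv 0 ^^ i) ((shifted_pderiv 1 ^^ j) f)) = degree f - i"
      using that(2) by (induction i) (use * in \<open>auto simp: degree_pderiv pderiv_eq_0_iff\<close>)
    then show ?thesis using that unfolding tau_def by (intro hankel_wronskian_nonzero) auto
  qed
  have mixed: "tau 0 0 (Suc n) f * tau 1 1 n f = tau 0 1 n f * tau 1 0 (Suc n) f - tau 1 0 n f * tau 0 1 (Suc n) f"
    and star: "tau 0 0 (Suc n) f * r 2 1 n f = tau 1 0 n f * tau 1 1 n f - tau 0 1 n f * tau 2 0 n f"
    using Suc.IH[of f] Suc.prems by auto
  have mixed': "tau 1 0 (Suc n) f * tau 2 1 n f = tau 1 1 n f * tau 2 0 (Suc n) f - tau 2 0 n f * tau 1 1 (Suc n) f"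
    using Suc.IH[of g] g by (simp add: sg numeral_2_eq_2)
  have alpha1: "tau 0 0 (Suc (Suc n)) f * tau 2 0 n f = tau 0 0 (Suc n) f * tau 2 0 (Suc n) f - tau 1 0 (Suc n) f * tau 1 0 (Suc n) f"
    using Suc.prems by (intro alpha) auto
  have alpha2: "tau 0 1 (Suc (Suc n)) f * tau 2 1 n f = tau 0 1 (Suc n) f * tau 2 1 (Suc n) f - tau 1 1 (Suc n) f * tau 1 1 (Suc n) f"
    using alpha[of h n] h Suc.prems by (simp add: sh)
  have gamma1: "tau 1 0 (Suc (Suc k)) f * tau 2 1 k f = tau 1 0 (Suc k) f * tau 2 1 (Suc k) f - tau 2 0 (Suc k) f * tau 1 1 (Suc k) f"
    if "k < degree g" for k
    using gamma[OF g(1) that] by (simp add: sg numeral_2_eq_2)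
  have gamma2: "tau 1 0 (Suc n) f * r 2 1 n f = tau 1 0 n f * tau 2 1 n f - tau 2 0 n f * tau 1 1 n f"
  proof (cases n)
    case 0
    then show ?thesis by (simp add: r_def tau_def)
  next
    case (Suc k)
    then show ?thesis using gamma1[of k] g(2) by (simp add: r_def)
  qed
  have starstar: "tau 0 0 (Suc n) f * tau 2 1 n f + tau 0 1 (Suc n) f * tau 2 0 n f = tau 1 0 (Suc n) f * tau 1 1 n f"
  proof -
    have "tau 1 0 n f * (tau 0 0 (Suc n) f * tau 2 1 n f + tau 0 1 (Suc n) f * tau 2 0 n f) =
        tau 1 0 n f * (tau 1 0 (Suc n) f * tau 1 1 n f)"
    proof -
      \<comment> \<open>The claim times \<open>tau 1 0 n f\<close> is a polynomial combination of
        three known relations, so every bracket vanishes, and \<open>nz\<close> permits cancelling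
        the factor. \<open>star'\<close> and the final identity are obtained in the same
        way.\<close>
      have "tau 1 0 n f * (tau 0 0 (Suc n) f * tau 2 1 n f + tau 0 1 (Suc n) f * tau 2 0 n f) -
          tau 1 0 n f * (tau 1 0 (Suc n) f * tau 1 1 n f) =
        tau 0 0 (Suc n) f * ((tau 1 0 n f * tau 2 1 n f - tau 2 0 n f * tau 1 1 n f) - tau 1 0 (Suc n) f * r 2 1 n f) +
        tau 2 0 n f * (tau 0 0 (Suc n) f * tau 1 1 n f - (tau 0 1 n f * tau 1 0 (Suc n) f - tau 1 0 n f * tau 0 1 (Suc n) f)) +
        tau 1 0 (Suc n) f * (tau 0 0 (Suc n) f * r 2 1 n f - (tau 1 0 n f * tau 1 1 n f - tau 0 1 n f * tau 2 0 n f))"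
        by (simp add: algebra_simps)
      then show ?thesis unfolding mixed gamma2 star by simp
    qed
    then show ?thesis using nz[of n 1 0] Suc.prems by simp
  qed
  have star': "tau 0 0 (Suc (Suc n)) f * tau 2 1 n f = tau 1 0 (Suc n) f * tau 1 1 (Suc n) f - tau 0 1 (Suc n) f * tau 2 0 (Suc n) f"
  proof -
    have "tau 2 0 n f * (tau 0 0 (Suc (Suc n)) f * tau 2 1 n f) =
        tau 2 0 n f * (tau 1 0 (Suc n) f * tau 1 1 (Suc n) f - tau 0 1 (Suc n) f * tau 2 0 (Suc n) f)"
    proof -
      have "tau 2 0 n f * (tau 0 0 (Suc (Suc n)) f * tau 2 1 n f) -
          tau 2 0 n f * (tau 1 0 (Suc n) f * tau 1 1 (Suc n) f - tau 0 1 (Suc n) f * tau 2 0 (Suc n) f) =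
        tau 2 1 n f * (tau 0 0 (Suc (Suc n)) f * tau 2 0 n f -
          (tau 0 0 (Suc n) f * tau 2 0 (Suc n) f - tau 1 0 (Suc n) f * tau 1 0 (Suc n) f)) +
        tau 2 0 (Suc n) f * (tau 0 0 (Suc n) f * tau 2 1 n f + tau 0 1 (Suc n) f * tau 2 0 n f - tau 1 0 (Suc n) f * tau 1 1 n f) -
        tau 1 0 (Suc n) f * (tau 1 0 (Suc n) f * tau 2 1 n f - (tau 1 1 n f * tau 2 0 (Suc n) f - tau 2 0 n f * tau 1 1 (Suc n) f))"
        by (simp add: algebra_simps)
      then show ?thesis unfolding alpha1 mixed' starstar by simp
    qed
    then show ?thesis using nz[of n 2 0] Suc.prems by simp
  qed
  have "tau 2 1 n f * (tau 0 0 (Suc (Suc n)) f * tau 1 1 (Suc n) f) =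
      tau 2 1 n f * (tau 0 1 (Suc n) f * tau 1 0 (Suc (Suc n)) f - tau 1 0 (Suc n) f * tau 0 1 (Suc (Suc n)) f)"
  proof -
    have "tau 2 1 n f * (tau 0 0 (Suc (Suc n)) f * tau 1 1 (Suc n) f) -
        tau 2 1 n f * (tau 0 1 (Suc n) f * tau 1 0 (Suc (Suc n)) f - tau 1 0 (Suc n) f * tau 0 1 (Suc (Suc n)) f) =
      tau 1 1 (Suc n) f * (tau 0 0 (Suc (Suc n)) f * tau 2 1 n f -
        (tau 1 0 (Suc n) f * tau 1 1 (Suc n) f - tau 0 1 (Suc n) f * tau 2 0 (Suc n) f)) -
      tau 0 1 (Suc n) f * (tau 1 0 (Suc (Suc n)) f * tau 2 1 n f -
        (tau 1 0 (Suc n) f * tau 2 1 (Suc n) f - tau 2 0 (Suc n) f * tau 1 1 (Suc n) f)) +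
      tau 1 0 (Suc n) f * (tau 0 1 (Suc (Suc n)) f * tau 2 1 n f -
        (tau 0 1 (Suc n) f * tau 2 1 (Suc n) f - tau 1 1 (Suc n) f * tau 1 1 (Suc n) f))"
      by (simp add: algebra_simps)
    then show ?thesis unfolding alpha2 gamma1[OF g(2)] star' by simp
  qed
  then have "tau 0 0 (Suc (Suc n)) f * tau 1 1 (Suc n) f =
      tau 0 1 (Suc n) f * tau 1 0 (Suc (Suc n)) f - tau 1 0 (Suc n) f * tau 0 1 (Suc (Suc n)) f"
    using nz[of n 2 1] Suc.prems by simp
  then show ?case using star' by (simp add: r_def)
qed

text \<open>Both relations are proved together by induction on \<open>n\<close>, for all
  \<open>f\<close> at once. The first at \<open>Suc n\<close> comes from the relations at
  \<open>n\<close> for \<open>f\<close> and for its image under \<open>D - c\<close>; the second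
  then comes from differentiating the Desnanot-Jacobi identity and inserting the first.\<close>

lemma hankel_wronskian_toda:
  fixes f :: "'a::field_char_0 poly"
  assumes "f \<noteq> 0" "n \<le> degree f"
  defines "t \<equiv> hankel_wronskian"
  defines "W \<equiv> \<lambda>p q. p * pderiv q - pderiv p * q"
  shows "n \<noteq> 0 \<Longrightarrow> W (t n f) (t n (shifted_pderiv c f)) = t (Suc n) f * t (n - 1) (shifted_pderiv c f)"
    and "W (t n (shifted_pderiv c f)) (t (Suc n) f) - Polynomial.smult c (t n (shifted_pderiv c f) * t (Suc n) f)
      = t (Suc n) (shifted_pderiv c f) * t n f"
proof -
  have "(n \<noteq> 0 \<longrightarrow> W (t n f) (t n (shifted_pderiv c f)) = t (Suc n) f * t (n - 1) (shifted_pderiv c f)) \<and>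
    W (t n (shifted_pderiv c f)) (t (Suc n) f) - [:c:] * (t n (shifted_pderiv c f) * t (Suc n) f)
      = t (Suc n) (shifted_pderiv c f) * t n f" (is "?A n f \<and> ?B n f")
    using assms(1,2)
  proof (induction n arbitrary: f)
    case 0
    then show ?case by (simp add: t_def W_def shifted_pderiv_def)
  next
    case (Suc n)
    let ?S = "shifted_pderiv c"
    have S: "?S f \<noteq> 0" "n \<le> degree (?S f)" if "Suc n \<le> degree f" for f
    proof -
      have "f \<noteq> 0" "degree f \<noteq> 0" using that by auto
      then show "?S f \<noteq> 0" by (simp add: shifted_pderiv_nonzero)
      show "n \<le> degree (?S f)" using that degree_shifted_pderiv_ge[of f c] by simp
    qed
    have dj: "t (Suc (Suc k)) f * t k (?S (?S f)) =
        t (Suc k) f * t (Suc k) (?S (?S f)) - t (Suc k) (?S f) * t (Suc k) (?S f)"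
      if "k < degree f" for k f
      unfolding t_def using that by (intro hankel_wronskian_desnanot_jacobi) auto
    have SS_nz: "t n (?S (?S f)) \<noteq> 0" if "Suc n \<le> degree f" for f
    proof (cases n)
      case (Suc k)
      have "?S (?S f) \<noteq> 0" using S[OF that] Suc by (auto simp: shifted_pderiv_nonzero)
      then show ?thesis unfolding t_def
        using Suc S[OF that] degree_shifted_pderiv_ge[of "?S f" c]
        by (intro hankel_wronskian_nonzero) auto
    qed (simp add: t_def)
    have B': "W (t n (?S (?S f))) (t (Suc n) (?S f)) - [:c:] * (t n (?S (?S f)) * t (Suc n) (?S f)) =
        t (Suc n) (?S (?S f)) * t n (?S f)" if "Suc n \<le> degree f" for f
      using Suc.IH[OF S[OF that]] by simp
    have A: "W (t (Suc n) f) (t (Suc n) (?S f)) = t (Suc (Suc n)) f * t n (?S f)"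
      if f: "Suc n \<le> degree f" for f
    proof -
      define g where "g = ?S f"
      define h where "h = ?S g"
      note g = S[OF f, folded g_def]
      \<comment> \<open>Reading the determinant of size \<open>-1\<close> as zero makes
        \<open>dj0\<close> and \<open>Ag\<close> hold for \<open>n = 0\<close> as well.\<close>
      define hm where "hm = (if n = 0 then 0 else t (n - 1) h)"
      have dj0: "t (Suc n) f * hm = t n f * t n h - t n g * t n g"
        using dj[of "n - 1" f] f by (cases n) (auto simp: hm_def t_def g_def h_def)
      have dj1: "t (Suc (Suc n)) f * t n h = t (Suc n) f * t (Suc n) h - t (Suc n) g * t (Suc n) g"
        using dj[of n f] f by (simp add: g_def h_def)
      have gn: "t n g \<noteq> 0"
        unfolding t_def using g by (intro hankel_wronskian_nonzero) auto
      have Ag: "W (t n g) (t n h) = t (Suc n) g * hm"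
        using Suc.IH[OF g] by (cases n) (auto simp: hm_def W_def t_def h_def)
      have Bg: "W (t n h) (t (Suc n) g) - [:c:] * (t n h * t (Suc n) g) = t (Suc n) h * t n g"
        using B'[OF f] by (simp add: h_def g_def)
      have Bf: "W (t n g) (t (Suc n) f) - [:c:] * (t n g * t (Suc n) f) = t (Suc n) g * t n f"
        using Suc.IH[of f] f by (cases "f = 0") (auto simp: g_def)
      \<comment> \<open>A syzygy: the claim times two nonzero determinants is a combination of
        \<open>Bg\<close>, \<open>Bf\<close>, \<open>Ag\<close>, \<open>dj0\<close> and
        \<open>dj1\<close>.\<close>
      have "t n h * t n g * (W (t (Suc n) f) (t (Suc n) g) - t (Suc (Suc n)) f * t n g) =
        t n g * t (Suc n) f * (W (t n h) (t (Suc n) g) - [:c:] * (t n h * t (Suc n) g) - t (Suc n) h * t n g) -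
        t n h * t (Suc n) g * (W (t n g) (t (Suc n) f) - [:c:] * (t n g * t (Suc n) f) - t (Suc n) g * t n f) +
        t (Suc n) f * t (Suc n) g * (W (t n g) (t n h) - t (Suc n) g * hm) +
        t (Suc n) g * t (Suc n) g * (t (Suc n) f * hm - (t n f * t n h - t n g * t n g)) -
        t n g * t n g * (t (Suc (Suc n)) f * t n h - (t (Suc n) f * t (Suc n) h - t (Suc n) g * t (Suc n) g))"
        unfolding W_def by (simp add: algebra_simps del: mult_pCons_left mult_pCons_right)
      also have "\<dots> = 0"
        unfolding Ag Bg Bf dj0 dj1 by simp
      finally show ?thesis using SS_nz[OF f] gn by (simp add: g_def h_def)
    qed
    have "W (t (Suc n) (?S f)) (t (Suc (Suc n)) f) - [:c:] * (t (Suc n) (?S f) * t (Suc (Suc n)) f) =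
        t (Suc (Suc n)) (?S f) * t (Suc n) f"
    proof -
      define g where "g = ?S f"
      define h where "h = ?S g"
      note f = \<open>Suc n \<le> degree f\<close>
      note g = S[OF f, folded g_def]
      have dj1: "t (Suc (Suc n)) f * t n h = t (Suc n) f * t (Suc n) h - t (Suc n) g * t (Suc n) g"
        using dj[of n f] f by (simp add: g_def h_def)
      have dj1': "pderiv (t (Suc (Suc n)) f) * t n h + t (Suc (Suc n)) f * pderiv (t n h) =
          pderiv (t (Suc n) f) * t (Suc n) h + t (Suc n) f * pderiv (t (Suc n) h) - 2 * t (Suc n) g * pderiv (t (Suc n) g)"
        using arg_cong[OF dj1, of pderiv] by (simp add: pderiv_mult pderiv_diff algebra_simps)
      have Bg: "W (t n h) (t (Suc n) g) - [:c:] * (t n h * t (Suc n) g) = t (Suc n) h * t n g"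
        using B'[OF f] by (simp add: h_def g_def)
      have Af: "W (t (Suc n) f) (t (Suc n) g) = t (Suc (Suc n)) f * t n g"
        using A[OF f] by (simp add: g_def)
      have Ag: "W (t (Suc n) g) (t (Suc n) h) = t (Suc (Suc n)) g * t n h"
      proof (cases "Suc n \<le> degree g")
        case True
        then show ?thesis using A[of g] by (simp add: h_def)
      next
        \<comment> \<open>The degree of \<open>g\<close> falls short only if \<open>c = 0\<close>.
          Then both sides vanish, since the derivatives of \<open>g\<close> of order
          \<open>Suc n\<close> and higher are zero.\<close>
        case False
        then have c: "c = 0"
          using f degree_shifted_pderiv[of c f] by (auto simp: g_def)
        have "(pderiv ^^ Suc n) g = 0" using False by (intro higher_pderiv_eq_0) simp
        then have "t (Suc (Suc n)) g = 0" "t (Suc n) h = 0"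
          unfolding t_def by (auto intro!: hankel_wronskian_eq_0 simp: h_def c funpow_Suc_right simp del: funpow.simps)
        then show ?thesis by (simp add: W_def)
      qed
      have "t n h * (W (t (Suc n) g) (t (Suc (Suc n)) f) - [:c:] * (t (Suc n) g * t (Suc (Suc n)) f)
          - t (Suc (Suc n)) g * t (Suc n) f) =
        t (Suc n) g * (pderiv (t (Suc (Suc n)) f) * t n h + t (Suc (Suc n)) f * pderiv (t n h) -
          (pderiv (t (Suc n) f) * t (Suc n) h + t (Suc n) f * pderiv (t (Suc n) h) - 2 * t (Suc n) g * pderiv (t (Suc n) g))) +
        t (Suc (Suc n)) f * (W (t n h) (t (Suc n) g) - [:c:] * (t n h * t (Suc n) g) - t (Suc n) h * t n g) -
        2 * pderiv (t (Suc n) g) * (t (Suc (Suc n)) f * t n h - (t (Suc n) f * t (Suc n) h - t (Suc n) g * t (Suc n) g)) -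
        t (Suc n) h * (W (t (Suc n) f) (t (Suc n) g) - t (Suc (Suc n)) f * t n g) +
        t (Suc n) f * (W (t (Suc n) g) (t (Suc n) h) - t (Suc (Suc n)) g * t n h)"
        unfolding W_def by (simp add: algebra_simps del: mult_pCons_left mult_pCons_right)
      also have "\<dots> = 0"
        unfolding dj1' Ag Bg Af dj1 by simp
      finally show ?thesis using SS_nz[OF f] by (simp add: g_def h_def)
    qed
    then show ?case using A Suc.prems by simp
  qed
  then show "n \<noteq> 0 \<Longrightarrow> W (t n f) (t n (shifted_pderiv c f)) = t (Suc n) f * t (n - 1) (shifted_pderiv c f)"
    and "W (t n (shifted_pderiv c f)) (t (Suc n) f) - Polynomial.smult c (t n (shifted_pderiv c f) * t (Suc n) f)
      = t (Suc n) (shifted_pderiv c f) * t n f"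
    by simp_all
qed

section \<open>The Toda chain\<close>

text \<open>The Toda chain exists for any nonzero polynomial of degree \<open>N\<close>; the
  Laguerre equation enters only in \<open>laguerre_chain\<close>.\<close>

locale hankel_wronskian_chain =
  fixes f :: "complex poly" and N :: nat
  assumes f_nonzero: "f \<noteq> 0" and degree_f: "degree f = N"
begin

text \<open>\<open>i\<close> and \<open>j\<close> count the factors \<open>x\<close> and \<open>x - 1\<close> of the weight.\<close>

definition tau :: "nat \<Rightarrow> nat \<Rightarrow> nat \<Rightarrow> complex poly" where
  "tau i j n = hankel_wronskian n ((shifted_pderiv 0 ^^ i) ((shifted_pderiv 1 ^^ j) f))"

text \<open>\<open>D - 1\<close> keeps the degree and \<open>D\<close> lowers it by one, so
  \<open>i\<close> alone restricts the admissible sizes \<open>n\<close>.\<close>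

lemma tau_nonzero:
  assumes "i \<le> N" "n + i \<le> N + 1"
  shows "tau i j n \<noteq> 0"
proof -
  have *: "(shifted_pderiv 1 ^^ j) f \<noteq> 0 \<and> degree ((shifted_pderiv 1 ^^ j) f) = N" for j
    by (induction j) (simp_all add: f_nonzero degree_f shifted_pderiv_nonzero degree_shifted_pderiv)
  have "(shifted_pderiv 0 ^^ i) ((shifted_pderiv 1 ^^ j) f) \<noteq> 0 \<and>
      degree ((shifted_pderiv 0 ^^ i) ((shifted_pderiv 1 ^^ j) f)) = N - i"
    using assms(1) by (induction i) (use * in \<open>auto simp: degree_pderiv pderiv_eq_0_iff\<close>)
  then show ?thesis using assms unfolding tau_def by (intro hankel_wronskian_nonzero) auto
qed

lemma tau_0 [simp]: "tau i j 0 = 1"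
  by (simp add: tau_def)

lemma tau_mixed:
  assumes "n < N"
  shows "tau 0 0 (Suc n) * tau 1 1 n = tau 0 1 n * tau 1 0 (Suc n) - tau 1 0 n * tau 0 1 (Suc n)"
  using hankel_wronskian_mixed[of f n] assms f_nonzero degree_f unfolding tau_def by blast

lemma tau_desnanot_jacobi:
  assumes "n < N"
  shows "tau 0 0 (Suc (Suc n)) * tau 1 1 n = tau 0 0 (Suc n) * tau 1 1 (Suc n) - tau 1 0 (Suc n) * tau 0 1 (Suc n)"
    and "tau 0 0 (Suc (Suc n)) * tau 2 0 n = tau 0 0 (Suc n) * tau 2 0 (Suc n) - tau 1 0 (Suc n) * tau 1 0 (Suc n)"
    and "tau 0 0 (Suc (Suc n)) * tau 0 2 n = tau 0 0 (Suc n) * tau 0 2 (Suc n) - tau 0 1 (Suc n) * tau 0 1 (Suc n)"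
  using hankel_wronskian_desnanot_jacobi[of f n 0 1] hankel_wronskian_desnanot_jacobi[of f n 0 0]
    hankel_wronskian_desnanot_jacobi[of f n 1 1] assms f_nonzero degree_f
  by (simp_all add: tau_def numeral_2_eq_2)

text \<open>The derivative of \<open>tau 1 0 n\<close> is eliminated between two relations of
  \<open>hankel_wronskian_toda\<close>, the second for \<open>f\<close> with \<open>c = 0\<close>
  and the first for \<open>pderiv f\<close> with \<open>c = 1\<close>. A Desnanot-Jacobi identity
  then lets \<open>tau 1 0 n\<close> cancel. The result makes \<open>U n\<close> a logarithmic
  derivative.\<close>

lemma tau_wronskian_11_00:
  assumes "n < N"
  shows "tau 1 1 n * pderiv (tau 0 0 (Suc n)) - pderiv (tau 1 1 n) * tau 0 0 (Suc n) = tau 0 1 n * tau 1 0 (Suc n)"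
proof -
  define hm where "hm = (if n = 0 then 0 else tau 1 1 (n - 1))"
  have g: "pderiv f \<noteq> 0" "n \<le> degree (pderiv f)"
    using assms f_nonzero degree_f by (auto simp: pderiv_eq_0_iff degree_pderiv)
  have B: "tau 1 0 n * pderiv (tau 0 0 (Suc n)) - pderiv (tau 1 0 n) * tau 0 0 (Suc n) = tau 1 0 (Suc n) * tau 0 0 n"
    using hankel_wronskian_toda(2)[of f n 0] assms f_nonzero degree_f by (simp add: tau_def)
  have A: "tau 1 0 n * pderiv (tau 1 1 n) - pderiv (tau 1 0 n) * tau 1 1 n = tau 1 0 (Suc n) * hm"
    using hankel_wronskian_toda(1)[OF g, of 1]
    by (cases "n = 0") (simp_all add: tau_def hm_def pderiv_shifted_pderiv)
  have G: "tau 0 0 (Suc n) * hm = tau 0 0 n * tau 1 1 n - tau 1 0 n * tau 0 1 n"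
    using tau_desnanot_jacobi(1)[of "n - 1"] assms by (cases n) (auto simp: hm_def)
  have "tau 1 0 n * (tau 1 1 n * pderiv (tau 0 0 (Suc n)) - pderiv (tau 1 1 n) * tau 0 0 (Suc n)) =
      tau 1 1 n * (tau 1 0 n * pderiv (tau 0 0 (Suc n)) - pderiv (tau 1 0 n) * tau 0 0 (Suc n)) -
      tau 0 0 (Suc n) * (tau 1 0 n * pderiv (tau 1 1 n) - pderiv (tau 1 0 n) * tau 1 1 n)"
    by (simp add: algebra_simps)
  also have "\<dots> = tau 1 0 (Suc n) * (tau 0 0 n * tau 1 1 n - tau 0 0 (Suc n) * hm)"
    unfolding A B by (simp add: algebra_simps)
  also have "\<dots> = tau 1 0 n * (tau 0 1 n * tau 1 0 (Suc n))"
    unfolding G by (simp add: algebra_simps)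
  finally show ?thesis using tau_nonzero[of 1 n 0] assms by simp
qed

text \<open>Here the derivative of \<open>tau 0 0 (Suc n)\<close> is eliminated between the first
  Toda relations for \<open>c = 0\<close> and \<open>c = 1\<close>, and \<open>tau_mixed\<close>
  makes the common factor appear. The result makes \<open>V (Suc n)\<close> a logarithmic
  derivative.\<close>

lemma tau_wronskian_01_10:
  assumes "n < N"
  shows "tau 0 1 (Suc n) * pderiv (tau 1 0 (Suc n)) - pderiv (tau 0 1 (Suc n)) * tau 1 0 (Suc n) =
    - (tau 1 1 n * tau 0 0 (Suc (Suc n)))"
proof -
  have A0: "tau 0 0 (Suc n) * pderiv (tau 1 0 (Suc n)) - pderiv (tau 0 0 (Suc n)) * tau 1 0 (Suc n) =
      tau 0 0 (Suc (Suc n)) * tau 1 0 n"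
    and A1: "tau 0 0 (Suc n) * pderiv (tau 0 1 (Suc n)) - pderiv (tau 0 0 (Suc n)) * tau 0 1 (Suc n) =
      tau 0 0 (Suc (Suc n)) * tau 0 1 n"
    using hankel_wronskian_toda(1)[of f "Suc n" 0] hankel_wronskian_toda(1)[of f "Suc n" 1] assms f_nonzero degree_f by (simp_all add: tau_def)
  have "tau 0 0 (Suc n) * (tau 0 1 (Suc n) * pderiv (tau 1 0 (Suc n)) - pderiv (tau 0 1 (Suc n)) * tau 1 0 (Suc n)) =
      tau 0 1 (Suc n) * (tau 0 0 (Suc n) * pderiv (tau 1 0 (Suc n)) - pderiv (tau 0 0 (Suc n)) * tau 1 0 (Suc n)) -
      tau 1 0 (Suc n) * (tau 0 0 (Suc n) * pderiv (tau 0 1 (Suc n)) - pderiv (tau 0 0 (Suc n)) * tau 0 1 (Suc n))"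
    by (simp add: algebra_simps)
  also have "\<dots> = - tau 0 0 (Suc (Suc n)) * (tau 0 1 n * tau 1 0 (Suc n) - tau 1 0 n * tau 0 1 (Suc n))"
    unfolding A0 A1 by (simp add: algebra_simps)
  also have "\<dots> = tau 0 0 (Suc n) * - (tau 1 1 n * tau 0 0 (Suc (Suc n)))"
    unfolding tau_mixed[OF assms, symmetric] by (simp add: algebra_simps)
  finally show ?thesis using tau_nonzero[of 0 "Suc n" 0] assms by (simp del: mult_minus_right)
qed

text \<open>A common set with finite complement on which quotients of determinants can be formed and
  differentiated freely; the determinants used below have \<open>i\<close> and \<open>j\<close> at
  most 2.\<close>

definition S :: "complex set" where
  "S = {z. z \<noteq> 0 \<and> (\<forall>i\<le>2. \<forall>j\<le>2. \<forall>n\<le>N + 1. i \<le> N \<longrightarrow> n + i \<le> N + 1 \<longrightarrow> poly (tau i j n) z \<noteq> 0)}"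

lemma finite_compl_S: "finite (- S)"
proof -
  have "- S \<subseteq> {0} \<union> (\<Union>(i, j, n)\<in>{(i, j, n). i \<le> 2 \<and> j \<le> 2 \<and> n \<le> N + 1 \<and> i \<le> N \<and> n + i \<le> N + 1}.
      {z. poly (tau i j n) z = 0})"
    by (auto simp: S_def)
  moreover have "finite {(i::nat, j::nat, n). i \<le> 2 \<and> j \<le> 2 \<and> n \<le> N + 1 \<and> i \<le> N \<and> n + i \<le> N + 1}"
    by (rule finite_subset[of _ "{..2} \<times> {..2} \<times> {..N + 1}"]) auto
  ultimately show ?thesis
    by (elim finite_subset) (auto intro!: poly_roots_finite simp: tau_nonzero)
qed

lemma open_S: "open S"
  using finite_imp_closed[OF finite_compl_S] by (simp add: closed_def)

lemma S_nonzero: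
  "z \<in> S \<Longrightarrow> z \<noteq> 0"
  "z \<in> S \<Longrightarrow> i \<le> 2 \<Longrightarrow> j \<le> 2 \<Longrightarrow> i \<le> N \<Longrightarrow> n + i \<le> N + 1 \<Longrightarrow> poly (tau i j n) z \<noteq> 0"
  by (auto simp: S_def)

text \<open>\<open>U n\<close> is \<open>u\<^bsub>N-n,n\<^esub>\<close> and \<open>V n\<close> is the function \<open>v\<close> of case (iii).\<close>

definition U :: "nat \<Rightarrow> complex \<Rightarrow> complex" where
  "U n z = poly (tau 0 1 n) z * poly (tau 1 0 (Suc n)) z / (poly (tau 1 1 n) z * poly (tau 0 0 (Suc n)) z)"

definition V :: "nat \<Rightarrow> complex \<Rightarrow> complex" where
  "V n z = (case n of 0 \<Rightarrow> 0 | Suc k \<Rightarrow>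
    - (poly (tau 1 1 k) z * poly (tau 0 0 (Suc n)) z / (poly (tau 1 0 n) z * poly (tau 0 1 n) z)))"

text \<open>This is \<open>tau_mixed\<close> divided by the denominator of \<open>U n\<close>. That
  \<open>1 - U n\<close> is again a single quotient makes its logarithmic derivative as simple as
  that of \<open>U n\<close>.\<close>

lemma one_minus_U:
  assumes "z \<in> S" "n < N"
  shows "1 - U n z = - (poly (tau 1 0 n) z * poly (tau 0 1 (Suc n)) z / (poly (tau 1 1 n) z * poly (tau 0 0 (Suc n)) z))"
proof -
  have *: "1 - a / b = - (c / b)" if "b \<noteq> 0" "b = a - c" for a b c :: complex
    using that by (simp add: divide_simps)
  have "poly (tau 1 1 n) z * poly (tau 0 0 (Suc n)) z \<noteq> 0"
    using assms by (simp add: S_nonzero(2))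
  moreover have "poly (tau 1 1 n) z * poly (tau 0 0 (Suc n)) z =
      poly (tau 0 1 n) z * poly (tau 1 0 (Suc n)) z - poly (tau 1 0 n) z * poly (tau 0 1 (Suc n)) z"
    using arg_cong[OF tau_mixed[OF assms(2)], of "\<lambda>p. poly p z"] by (simp add: mult.commute)
  ultimately show ?thesis unfolding U_def by (rule *)
qed

text \<open>The analogue for \<open>V\<close>, from the Desnanot-Jacobi identity with the factors
  \<open>x\<close> and \<open>x - 1\<close>.\<close>

lemma one_minus_V:
  assumes "z \<in> S" "n < N"
  shows "1 - V (Suc n) z =
    poly (tau 0 0 (Suc n)) z * poly (tau 1 1 (Suc n)) z / (poly (tau 1 0 (Suc n)) z * poly (tau 0 1 (Suc n)) z)"
proof -
  have *: "1 - - (a / b) = c / b" if "b \<noteq> 0" "a = c - b" for a b c :: complex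
    using that by (simp add: divide_simps)
  have "poly (tau 1 0 (Suc n)) z * poly (tau 0 1 (Suc n)) z \<noteq> 0"
    using assms by (simp add: S_nonzero(2))
  moreover have "poly (tau 1 1 n) z * poly (tau 0 0 (Suc (Suc n))) z =
      poly (tau 0 0 (Suc n)) z * poly (tau 1 1 (Suc n)) z - poly (tau 1 0 (Suc n)) z * poly (tau 0 1 (Suc n)) z"
    using arg_cong[OF tau_desnanot_jacobi(1)[OF assms(2)], of "\<lambda>p. poly p z"] by (simp add: mult.commute)
  ultimately show ?thesis unfolding V_def nat.case by (rule *)
qed

lemma U_nontrivial:
  assumes "z \<in> S" "n < N"
  shows "U n z \<noteq> 0" "1 - U n z \<noteq> 0" "V (Suc n) z \<noteq> 0" "1 - V (Suc n) z \<noteq> 0"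
proof -
  show "1 - U n z \<noteq> 0" "1 - V (Suc n) z \<noteq> 0"
    using assms unfolding one_minus_U[OF assms] one_minus_V[OF assms] by (auto simp: S_nonzero)
  show "U n z \<noteq> 0" "V (Suc n) z \<noteq> 0"
    using assms unfolding U_def V_def by (auto simp: S_nonzero)
qed

end

abbreviation pderiv_log :: "complex poly \<Rightarrow> complex \<Rightarrow> complex" where
  "pderiv_log p z \<equiv> poly (pderiv p) z / poly p z"

lemma DERIV_poly_product_quotient:
  fixes a b c d :: "complex poly"
  assumes "poly a z \<noteq> 0" "poly b z \<noteq> 0" "poly c z \<noteq> 0" "poly d z \<noteq> 0"
  shows "((\<lambda>z. poly a z * poly b z / (poly c z * poly d z)) has_field_derivative
    (poly a z * poly b z / (poly c z * poly d z)) *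
      (pderiv_log a z + pderiv_log b z - pderiv_log c z - pderiv_log d z)) (at z)"
  by (rule derivative_eq_intros refl poly_DERIV | use assms in \<open>simp add: field_simps\<close>)+

context hankel_wronskian_chain
begin

lemma U_eq_pderiv_log:
  assumes "z \<in> S" "n < N"
  shows "U n z = pderiv_log (tau 0 0 (Suc n)) z - pderiv_log (tau 1 1 n) z"
proof -
  have "poly (tau 1 1 n) z \<noteq> 0" "poly (tau 0 0 (Suc n)) z \<noteq> 0"
    using assms by (simp_all add: S_nonzero(2))
  then show ?thesis
    unfolding U_def using arg_cong[OF tau_wronskian_11_00[OF assms(2)], of "\<lambda>p. poly p z"]
    by (simp add: diff_frac_eq mult_ac del: One_nat_def)
qed

lemma V_eq_pderiv_log:
  assumes "z \<in> S" "n \<le> N"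
  shows "V n z = pderiv_log (tau 1 0 n) z - pderiv_log (tau 0 1 n) z"
proof (cases n)
  case 0
  then show ?thesis by (simp add: V_def)
next
  case (Suc k)
  have "poly (tau 1 0 n) z \<noteq> 0" "poly (tau 0 1 n) z \<noteq> 0"
    using assms Suc by (simp_all add: S_nonzero(2))
  then show ?thesis
    unfolding V_def using arg_cong[OF tau_wronskian_01_10[of k], of "\<lambda>p. poly p z"] assms Suc
    by (simp add: diff_frac_eq mult_ac del: One_nat_def)
qed

text \<open>Let \<open>d\<close> and \<open>e\<close> be the logarithmic derivatives of
  \<open>U n\<close> and \<open>1 - U n\<close>. As the sum of the two functions is constant,
  \<open>U n * d + (1 - U n) * e = 0\<close>, hence \<open>d = (1 - U n) * (d - e)\<close>. In
  \<open>d - e\<close> the common denominators cancel and \<open>V_eq_pderiv_log\<close> applies.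
  The proof of \<open>DERIV_V\<close> is parallel.\<close>

lemma DERIV_U:
  assumes "z \<in> S" "n < N"
  shows "(U n has_field_derivative U n z * (1 - U n z) * (V (Suc n) z - V n z)) (at z)"
proof -
  let ?A = "tau 0 1 n" and ?B = "tau 1 0 (Suc n)" and ?C = "tau 1 0 n" and ?D = "tau 0 1 (Suc n)"
  have nz: "poly ?A z \<noteq> 0" "poly ?B z \<noteq> 0" "poly ?C z \<noteq> 0" "poly ?D z \<noteq> 0"
    "poly (tau 1 1 n) z \<noteq> 0" "poly (tau 0 0 (Suc n)) z \<noteq> 0"
    using assms by (simp_all add: S_nonzero(2))
  define d where "d = pderiv_log ?A z + pderiv_log ?B z - pderiv_log (tau 1 1 n) z - pderiv_log (tau 0 0 (Suc n)) z"
  define e where "e = pderiv_log ?C z + pderiv_log ?D z - pderiv_log (tau 1 1 n) z - pderiv_log (tau 0 0 (Suc n)) z"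
  have U: "(U n has_field_derivative U n z * d) (at z)"
    unfolding U_def[abs_def] d_def by (rule DERIV_poly_product_quotient) (use nz in auto)
  have "((\<lambda>w. - (poly ?C w * poly ?D w / (poly (tau 1 1 n) w * poly (tau 0 0 (Suc n)) w)))
      has_field_derivative - (poly ?C z * poly ?D z / (poly (tau 1 1 n) z * poly (tau 0 0 (Suc n)) z) * e)) (at z)"
    unfolding e_def by (intro DERIV_minus DERIV_poly_product_quotient) (use nz in auto)
  also have "- (poly ?C z * poly ?D z / (poly (tau 1 1 n) z * poly (tau 0 0 (Suc n)) z) * e) = (1 - U n z) * e"
    using one_minus_U[OF assms] by simp
  finally have "((\<lambda>w. 1 - U n w) has_field_derivative (1 - U n z) * e) (at z)"
    by (rule has_field_derivative_transform_within_open[OF _ open_S assms(1)])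
      (use assms(2) in \<open>simp add: one_minus_U\<close>)
  moreover have "((\<lambda>w. 1 - U n w) has_field_derivative - (U n z * d)) (at z)"
    by (rule derivative_eq_intros U refl | simp)+
  ultimately have "(1 - U n z) * e = - (U n z * d)" by (rule DERIV_unique)
  then have "d = (1 - U n z) * (d - e)" by (simp add: algebra_simps)
  also have "d - e = V (Suc n) z - V n z"
    using V_eq_pderiv_log[of z n] V_eq_pderiv_log[of z "Suc n"] assms by (simp add: d_def e_def)
  finally have "d = (1 - U n z) * (V (Suc n) z - V n z)" .
  with U show ?thesis by (simp add: mult.assoc)
qed

lemma DERIV_V:
  assumes "z \<in> S" "Suc n < N"
  shows "(V (Suc n) has_field_derivative V (Suc n) z * (1 - V (Suc n) z) * (U (Suc n) z - U n z)) (at z)"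
proof -
  let ?A = "tau 1 1 n" and ?B = "tau 0 0 (Suc (Suc n))" and ?C = "tau 0 0 (Suc n)" and ?D = "tau 1 1 (Suc n)"
  have nz: "poly ?A z \<noteq> 0" "poly ?B z \<noteq> 0" "poly ?C z \<noteq> 0" "poly ?D z \<noteq> 0"
    "poly (tau 1 0 (Suc n)) z \<noteq> 0" "poly (tau 0 1 (Suc n)) z \<noteq> 0"
    using assms by (simp_all add: S_nonzero(2))
  define d where "d = pderiv_log ?A z + pderiv_log ?B z - pderiv_log (tau 1 0 (Suc n)) z - pderiv_log (tau 0 1 (Suc n)) z"
  define e where "e = pderiv_log ?C z + pderiv_log ?D z - pderiv_log (tau 1 0 (Suc n)) z - pderiv_log (tau 0 1 (Suc n)) z"
  have "((\<lambda>w. - (poly ?A w * poly ?B w / (poly (tau 1 0 (Suc n)) w * poly (tau 0 1 (Suc n)) w)))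
      has_field_derivative - (poly ?A z * poly ?B z / (poly (tau 1 0 (Suc n)) z * poly (tau 0 1 (Suc n)) z) * d)) (at z)"
    unfolding d_def by (intro DERIV_minus DERIV_poly_product_quotient) (use nz in auto)
  then have V: "(V (Suc n) has_field_derivative V (Suc n) z * d) (at z)"
    by (simp add: V_def[abs_def])
  have "((\<lambda>w. poly ?C w * poly ?D w / (poly (tau 1 0 (Suc n)) w * poly (tau 0 1 (Suc n)) w))
      has_field_derivative poly ?C z * poly ?D z / (poly (tau 1 0 (Suc n)) z * poly (tau 0 1 (Suc n)) z) * e) (at z)"
    unfolding e_def by (rule DERIV_poly_product_quotient) (use nz in auto)
  also have "poly ?C z * poly ?D z / (poly (tau 1 0 (Suc n)) z * poly (tau 0 1 (Suc n)) z) * e = (1 - V (Suc n) z) * e"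
    using one_minus_V[of z n] assms by simp
  finally have "((\<lambda>w. 1 - V (Suc n) w) has_field_derivative (1 - V (Suc n) z) * e) (at z)"
    by (rule has_field_derivative_transform_within_open[OF _ open_S assms(1)])
      (use assms(2) in \<open>simp add: one_minus_V\<close>)
  moreover have "((\<lambda>w. 1 - V (Suc n) w) has_field_derivative - (V (Suc n) z * d)) (at z)"
    by (rule derivative_eq_intros V refl | simp)+
  ultimately have "(1 - V (Suc n) z) * e = - (V (Suc n) z * d)" by (rule DERIV_unique)
  then have "d = (1 - V (Suc n) z) * (d - e)" by (simp add: algebra_simps)
  also have "d - e = U (Suc n) z - U n z"
    using U_eq_pderiv_log[of z n] U_eq_pderiv_log[of z "Suc n"] assms by (simp add: d_def e_def)
  finally have "d = (1 - V (Suc n) z) * (U (Suc n) z - U n z)" .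
  with V show ?thesis by (simp add: mult.assoc)
qed

lemma V_differentiable:
  assumes "z \<in> S" "n \<le> N"
  shows "V n field_differentiable at z"
proof (cases n)
  case 0
  then show ?thesis by (simp add: V_def[abs_def])
next
  case (Suc k)
  have "poly (tau 1 0 n) z \<noteq> 0" "poly (tau 0 1 n) z \<noteq> 0"
    using assms Suc by (simp_all add: S_nonzero(2))
  moreover have "poly p field_differentiable at z" for p :: "complex poly"
    unfolding field_differentiable_def using poly_DERIV by blast
  ultimately show ?thesis
    unfolding Suc V_def[abs_def] by (auto intro!: derivative_intros)
qed

end

text \<open>Both equations of the system have this form, the second one with \<open>(x, y) = (v, 1 - u)\<close>.\<close>

definition PV_equation ::
  "complex \<Rightarrow> complex \<Rightarrow> (complex \<Rightarrow> complex) \<Rightarrow> (complex \<Rightarrow> complex) \<Rightarrow> complex \<Rightarrow> bool" where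
  "PV_equation a b x y z \<longleftrightarrow>
    z * deriv x z = z * (2 * y z - 1) * x z * (x z - 1) + a * (1 - x z) - b * x z"

text \<open>The Toda equation for \<open>x\<close> turns the differential equation of
  \<open>x\<close> into the relation \<open>R\<close>, free of derivatives and symmetric in
  \<open>y\<close> and \<open>y'\<close>. Differentiating \<open>R\<close> yields the equation for
  \<open>y'\<close>; reading it with \<open>y\<close> and \<open>y'\<close> exchanged yields the
  equation for \<open>x\<close> with negated parameters. The role of \<open>x\<close> is played
  alternately by \<open>U\<close> and \<open>V\<close>.\<close>

lemma PV_step:
  fixes x y y' :: "complex \<Rightarrow> complex"
  assumes S: "open S" "\<And>w. w \<in> S \<Longrightarrow> x w \<noteq> 0 \<and> 1 - x w \<noteq> 0"
    and x: "\<And>w. w \<in> S \<Longrightarrow> (x has_field_derivative x w * (1 - x w) * (y' w - y w)) (at w)"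
    and y: "\<And>w. w \<in> S \<Longrightarrow> y field_differentiable at w"
    and y': "\<And>w. w \<in> S \<Longrightarrow> y' field_differentiable at w"
    and eq_x: "\<And>w. w \<in> S \<Longrightarrow> PV_equation p q x y w"
    and eq_y: "\<And>w. w \<in> S \<Longrightarrow> PV_equation r t y (\<lambda>w. 1 - x w) w"
    and sum: "p + q + r + t = 1"
    and z: "z \<in> S"
  shows "PV_equation (1 - r) (1 - t) y' x z" "PV_equation (- p) (- q) x (\<lambda>w. 1 - y' w) z"
proof -
  have dx: "deriv x w = x w * (1 - x w) * (y' w - y w)" if "w \<in> S" for w
    using x[OF that] by (rule DERIV_imp_deriv)
  have R: "w * x w * (1 - x w) * (y' w + y w - 1) - p * (1 - x w) + q * x w = 0" if "w \<in> S" for w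
    using eq_x[OF that] unfolding PV_equation_def dx[OF that] by (simp add: algebra_simps)
  have "((\<lambda>w. w * x w * (1 - x w) * (y' w + y w - 1) - p * (1 - x w) + q * x w) has_field_derivative
      x z * (1 - x z) * (y' z + y z - 1) + z * (1 - 2 * x z) * deriv x z * (y' z + y z - 1) +
      z * x z * (1 - x z) * (deriv y' z + deriv y z) + (p + q) * deriv x z) (at z)"
    by (rule derivative_eq_intros refl x[OF z] y[OF z, THEN field_differentiable_derivI]
        y'[OF z, THEN field_differentiable_derivI] | simp add: dx[OF z] algebra_simps)+
  moreover have "((\<lambda>w. w * x w * (1 - x w) * (y' w + y w - 1) - p * (1 - x w) + q * x w)
      has_field_derivative 0) (at z)"
    by (rule has_field_derivative_transform_within_open[OF DERIV_const S(1) z]) (simp add: R)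
  ultimately have "x z * (1 - x z) * ((y' z + y z - 1) + z * (y' z - y z) * (1 - 2 * x z) * (y' z + y z - 1) +
      z * (deriv y' z + deriv y z) + (p + q) * (y' z - y z)) = 0"
    using DERIV_unique by (fastforce simp: dx[OF z] algebra_simps)
  then have "(y' z + y z - 1) + z * (y' z - y z) * (1 - 2 * x z) * (y' z + y z - 1) +
      z * (deriv y' z + deriv y z) + (p + q) * (y' z - y z) = 0"
    using S(2)[OF z] unfolding mult_eq_0_iff by blast
  then have "z * deriv y' z = - z * deriv y z - (y' z + y z - 1) -
      z * (y' z - y z) * (1 - 2 * x z) * (y' z + y z - 1) - (p + q) * (y' z - y z)"
    by (simp add: algebra_simps)
  moreover have pq: "p + q = 1 - r - t" using sum by (simp add: algebra_simps)
  ultimately show "PV_equation (1 - r) (1 - t) y' x z"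
    using eq_y[OF z] unfolding PV_equation_def pq by (simp add: algebra_simps)
  show "PV_equation (- p) (- q) x (\<lambda>w. 1 - y' w) z"
    using R[OF z] unfolding PV_equation_def dx[OF z] by (simp add: algebra_simps)
qed

section \<open>The Painleve system along the chain\<close>

locale laguerre_chain = hankel_wronskian_chain +
  fixes \<mu> :: complex
  assumes laguerre_equation:
    "z * poly (pderiv (pderiv f)) z + (\<mu> + 1 - z) * poly (pderiv f) z + of_nat N * poly f z = 0"
begin

lemma U_ne_1: "z \<in> S \<Longrightarrow> n < N \<Longrightarrow> U n z \<noteq> 1"
  and V_ne_1: "z \<in> S \<Longrightarrow> n < N \<Longrightarrow> V (Suc n) z \<noteq> 1"
  using U_nontrivial(2,4) by auto

text \<open>Half a step along the chain: \<open>PV_step\<close> with \<open>x = U n\<close>,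
  \<open>y = V n\<close> and \<open>y' = V (Suc n)\<close>. Up to a flip, the conclusions are the
  two equations of case (ii).\<close>

lemma PV_U_V_step:
  assumes n: "n < N"
    and U: "\<And>z. z \<in> S \<Longrightarrow> PV_equation (of_nat n - of_nat N) (\<mu> + of_nat N + of_nat n + 1) (U n) (V n) z"
    and V: "\<And>z. z \<in> S \<Longrightarrow> PV_equation (- of_nat n) (- of_nat n - \<mu>) (V n) (\<lambda>w. 1 - U n w) z"
    and z: "z \<in> S"
  shows "PV_equation (of_nat n + 1) (\<mu> + of_nat n + 1) (V (Suc n)) (U n) z"
    "PV_equation (of_nat N - of_nat n) (- \<mu> - of_nat N - of_nat n - 1) (U n) (\<lambda>w. 1 - V (Suc n) w) z"
proof -
  note step = PV_step[OF open_S _ DERIV_U[OF _ n] V_differentiable V_differentiable U V _ z]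
  have "PV_equation (1 - - of_nat n) (1 - (- of_nat n - \<mu>)) (V (Suc n)) (U n) z"
    by (rule step(1)) (use n in \<open>auto simp: U_nontrivial(1) U_ne_1\<close>)
  then show "PV_equation (of_nat n + 1) (\<mu> + of_nat n + 1) (V (Suc n)) (U n) z"
    by (simp add: algebra_simps)
  have "PV_equation (- (of_nat n - of_nat N)) (- (\<mu> + of_nat N + of_nat n + 1)) (U n) (\<lambda>w. 1 - V (Suc n) w) z"
    by (rule step(2)) (use n in \<open>auto simp: U_nontrivial(1) U_ne_1\<close>)
  moreover have "- (of_nat n - of_nat N) = (of_nat N - of_nat n :: complex)"
    "- (\<mu> + of_nat N + of_nat n + 1) = - \<mu> - of_nat N - of_nat n - 1" by simp_all
  ultimately show "PV_equation (of_nat N - of_nat n) (- \<mu> - of_nat N - of_nat n - 1) (U n) (\<lambda>w. 1 - V (Suc n) w) z"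
    by (simp only:)
qed

lemma PV_U_V:
  assumes "n < N" "z \<in> S"
  shows "PV_equation (of_nat n - of_nat N) (\<mu> + of_nat N + of_nat n + 1) (U n) (V n) z \<and>
    PV_equation (- of_nat n) (- of_nat n - \<mu>) (V n) (\<lambda>w. 1 - U n w) z"
  using assms
proof (induction n arbitrary: z)
  case 0
  have fz: "poly f z \<noteq> 0" and z: "z \<noteq> 0"
    using S_nonzero(2)[OF 0(2), of 0 0 1] S_nonzero(1)[OF 0(2)] by (simp_all add: tau_def)
  have U0: "U 0 = (\<lambda>z. poly (pderiv f) z / poly f z)"
    by (simp add: U_def[abs_def] tau_def)
  have "(U 0 has_field_derivative
      (poly (pderiv (pderiv f)) z * poly f z - poly (pderiv f) z * poly (pderiv f) z) / (poly f z * poly f z)) (at z)"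
    unfolding U0 by (rule derivative_eq_intros poly_DERIV refl fz)+
  then have d: "deriv (U 0) z = poly (pderiv (pderiv f)) z / poly f z - U 0 z * U 0 z"
    using fz by (simp add: DERIV_imp_deriv U0 diff_divide_distrib)
  have "z * poly (pderiv (pderiv f)) z = - ((\<mu> + 1 - z) * poly (pderiv f) z + of_nat N * poly f z)"
    using laguerre_equation[of z] by (simp only: eq_neg_iff_add_eq_0 add.assoc)
  then have "z * (poly (pderiv (pderiv f)) z / poly f z) = - ((\<mu> + 1 - z) * U 0 z + of_nat N)"
    using fz by (simp add: U0 diff_divide_distrib)
  then have "PV_equation (- of_nat N) (\<mu> + of_nat N + 1) (U 0) (V 0) z"
    unfolding PV_equation_def d by (simp add: V_def algebra_simps)
  moreover have "PV_equation 0 (- \<mu>) (V 0) (\<lambda>w. 1 - U 0 w) z"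
    by (simp add: PV_equation_def V_def[abs_def])
  ultimately show ?case by simp
next
  case (Suc n)
  have n: "n < N" "Suc n \<le> N" using Suc.prems by auto
  note half = PV_U_V_step[OF n(1) Suc.IH[OF n(1), THEN conjunct1] Suc.IH[OF n(1), THEN conjunct2]]
  have U_diff: "U k field_differentiable at w" if "k < N" "w \<in> S" for k w
    using DERIV_U[OF that(2,1)] by (auto simp: field_differentiable_def)
  \<comment> \<open>In the second half of the step \<open>V (Suc n)\<close> takes the role of
    \<open>x\<close>, and \<open>U n\<close> and \<open>U (Suc n)\<close> those of \<open>y\<close>
    and \<open>y'\<close>.\<close>
  note step = PV_step[OF open_S _ DERIV_V[OF _ Suc.prems(1)] U_diff U_diff half(1) half(2) _ Suc.prems(2)]
  have "PV_equation (1 - (of_nat N - of_nat n)) (1 - (- \<mu> - of_nat N - of_nat n - 1)) (U (Suc n)) (V (Suc n)) z"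
    by (rule step(1)) (use Suc.prems n in \<open>auto simp: U_nontrivial(3) V_ne_1\<close>)
  moreover have "PV_equation (- (of_nat n + 1)) (- (\<mu> + of_nat n + 1)) (V (Suc n)) (\<lambda>w. 1 - U (Suc n) w) z"
    by (rule step(2)) (use Suc.prems n in \<open>auto simp: U_nontrivial(3) V_ne_1\<close>)
  ultimately show ?case by (simp add: algebra_simps)
qed

lemmas PV_U_V_Suc = PV_U_V_step[OF _ PV_U_V[THEN conjunct1] PV_U_V[THEN conjunct2]]

section \<open>Closed forms of the reflected functions\<close>

text \<open>Obtained by equating the derivative of \<open>U n\<close> given by the system with the
  one given by the Toda chain. It determines \<open>V (Suc n)\<close> from \<open>U n\<close> and
  \<open>V n\<close>.\<close>

lemma U_relation:
  assumes "n < N" "z \<in> S"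
  shows "z * U n z * (1 - U n z) * (V (Suc n) z + V n z - 1) + (of_nat N - of_nat n) * (1 - U n z) +
    (\<mu> + of_nat N + of_nat n + 1) * U n z = 0"
  using PV_U_V[OF assms] DERIV_imp_deriv[OF DERIV_U[OF assms(2,1)]]
  unfolding PV_equation_def by (simp add: algebra_simps)

lemma V_relation:
  assumes "Suc n < N" "z \<in> S"
  shows "z * V (Suc n) z * (1 - V (Suc n) z) * (U (Suc n) z + U n z - 1) =
    (of_nat n + 1) * (1 - V (Suc n) z) - (\<mu> + of_nat n + 1) * V (Suc n) z"
  using PV_U_V_Suc(1)[of n z] assms DERIV_imp_deriv[OF DERIV_V[OF assms(2,1)]]
  unfolding PV_equation_def by (simp add: algebra_simps)

text \<open>In these products \<open>tau 1 1\<close> cancels, together with \<open>tau 0 1\<close>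
  in the first two and \<open>tau 1 0\<close> in the last two. What remains are the multipliers that
  carry the quotients of \<open>tau_20_eq\<close> and \<open>tau_02_eq\<close> from \<open>n\<close>
  to \<open>Suc n\<close>.\<close>

lemma U_V_factors:
  assumes "Suc n < N" "z \<in> S"
  shows "(1 - U n z) * V (Suc n) z =
      poly (tau 1 0 n) z * poly (tau 0 0 (Suc (Suc n))) z / (poly (tau 0 0 (Suc n)) z * poly (tau 1 0 (Suc n)) z)"
    and "U (Suc n) z * (1 - V (Suc n) z) =
      poly (tau 1 0 (Suc (Suc n))) z * poly (tau 0 0 (Suc n)) z / (poly (tau 0 0 (Suc (Suc n))) z * poly (tau 1 0 (Suc n)) z)"
    and "U n z * V (Suc n) z =
      - (poly (tau 0 1 n) z * poly (tau 0 0 (Suc (Suc n))) z / (poly (tau 0 0 (Suc n)) z * poly (tau 0 1 (Suc n)) z))"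
    and "(1 - U (Suc n) z) * (1 - V (Suc n) z) =
      - (poly (tau 0 1 (Suc (Suc n))) z * poly (tau 0 0 (Suc n)) z / (poly (tau 0 0 (Suc (Suc n))) z * poly (tau 0 1 (Suc n)) z))"
proof -
  have n: "n < N" using assms by simp
  have nz: "poly (tau 0 0 (Suc n)) z \<noteq> 0" "poly (tau 0 0 (Suc (Suc n))) z \<noteq> 0"
     "poly (tau 1 0 (Suc n)) z \<noteq> 0" "poly (tau 0 1 (Suc n)) z \<noteq> 0"
     "poly (tau 1 1 (Suc n)) z \<noteq> 0" "poly (tau 1 1 n) z \<noteq> 0"
    using assms by (simp_all add: S_nonzero(2))
  show "(1 - U n z) * V (Suc n) z =
      poly (tau 1 0 n) z * poly (tau 0 0 (Suc (Suc n))) z / (poly (tau 0 0 (Suc n)) z * poly (tau 1 0 (Suc n)) z)"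
    using nz unfolding one_minus_U[OF assms(2) n] V_def nat.case by (simp add: field_simps del: One_nat_def)
  show "U (Suc n) z * (1 - V (Suc n) z) =
      poly (tau 1 0 (Suc (Suc n))) z * poly (tau 0 0 (Suc n)) z / (poly (tau 0 0 (Suc (Suc n))) z * poly (tau 1 0 (Suc n)) z)"
    using nz unfolding one_minus_V[OF assms(2) n] U_def by (simp add: field_simps del: One_nat_def)
  show "U n z * V (Suc n) z =
      - (poly (tau 0 1 n) z * poly (tau 0 0 (Suc (Suc n))) z / (poly (tau 0 0 (Suc n)) z * poly (tau 0 1 (Suc n)) z))"
    using nz unfolding U_def V_def nat.case by (simp add: field_simps del: One_nat_def)
  show "(1 - U (Suc n) z) * (1 - V (Suc n) z) =
      - (poly (tau 0 1 (Suc (Suc n))) z * poly (tau 0 0 (Suc n)) z / (poly (tau 0 0 (Suc (Suc n))) z * poly (tau 0 1 (Suc n)) z))"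
    using nz unfolding one_minus_V[OF assms(2) n] one_minus_U[OF assms(2,1)]
    by (simp add: field_simps del: One_nat_def)
qed

text \<open>This identifies the determinant quotient of case (i): divided by \<open>z\<close>, the
  right side is \<open>V n\<close> after the reflection. Both sides obey the same recurrence, the
  left by the Desnanot-Jacobi identity for \<open>tau 2 0\<close>, the right by
  \<open>U_relation\<close> and \<open>V_relation\<close>.\<close>

lemma tau_20_eq:
  assumes "n < N" "z \<in> S"
  shows "of_nat N * (poly (tau 0 0 (Suc n)) z * poly (tau 2 0 n) z / (poly (tau 1 0 n) z * poly (tau 1 0 (Suc n)) z)) =
    z * V n z + (of_nat N - of_nat n) / U n z"
  using assms
proof (induction n)
  case 0
  then have "poly (tau 0 0 (Suc 0)) z \<noteq> 0" "poly (tau 1 0 (Suc 0)) z \<noteq> 0" by (simp_all add: S_nonzero(2))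
  then show ?case by (simp add: U_def V_def)
next
  case (Suc n)
  define P where "P k = poly (tau 0 0 (Suc k)) z * poly (tau 2 0 k) z / (poly (tau 1 0 k) z * poly (tau 1 0 (Suc k)) z)" for k
  let ?u = "U n z" and ?u1 = "U (Suc n) z" and ?v = "V n z" and ?v1 = "V (Suc n) z"
  have n: "n < N" "n < N - 1" using Suc.prems by auto
  have nz: "?u \<noteq> 0" "1 - ?u \<noteq> 0" "?u1 \<noteq> 0" "1 - ?v1 \<noteq> 0"
    using U_nontrivial[of z n] U_nontrivial[of z "Suc n"] Suc.prems n by auto
  have sn: "poly (tau 0 0 (Suc n)) z \<noteq> 0" "poly (tau 0 0 (Suc (Suc n))) z \<noteq> 0" "poly (tau 1 0 n) z \<noteq> 0"
     "poly (tau 1 0 (Suc n)) z \<noteq> 0" "poly (tau 1 0 (Suc (Suc n))) z \<noteq> 0" "poly (tau 0 1 (Suc n)) z \<noteq> 0"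
     "poly (tau 1 1 (Suc n)) z \<noteq> 0" "poly (tau 1 1 n) z \<noteq> 0"
    using Suc.prems by (simp_all add: S_nonzero(2))
  have "P n * ((1 - ?u) * ?v1) = poly (tau 0 0 (Suc (Suc n)) * tau 2 0 n) z / (poly (tau 1 0 (Suc n)) z * poly (tau 1 0 (Suc n)) z)"
    unfolding U_V_factors(1)[OF Suc.prems] P_def using sn by (simp add: field_simps)
  also have "\<dots> = poly (tau 0 0 (Suc n)) z * poly (tau 2 0 (Suc n)) z / (poly (tau 1 0 (Suc n)) z * poly (tau 1 0 (Suc n)) z) - 1"
    unfolding tau_desnanot_jacobi(2)[OF n(1)] using sn by (simp add: diff_divide_distrib)
  also have "\<dots> = P (Suc n) * (?u1 * (1 - ?v1)) - 1"
    unfolding U_V_factors(2)[OF Suc.prems] P_def using sn by (simp add: field_simps)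
  finally have P: "P (Suc n) * (?u1 * (1 - ?v1)) = P n * ((1 - ?u) * ?v1) + 1" by simp
  have IH: "of_nat N * P n = z * ?v + (of_nat N - of_nat n) / ?u"
    using Suc.IH n Suc.prems by (simp add: P_def)
  \<comment> \<open>\<open>U_relation\<close> removes \<open>V n\<close> and the denominator
    \<open>U n\<close> from the right side at \<open>n\<close>; afterwards \<open>V_relation\<close>
    brings in \<open>U (Suc n)\<close>.\<close>
  have "?u * ((z * ?v + (of_nat N - of_nat n) / ?u) * (1 - ?u)) =
      z * ?v * ?u * (1 - ?u) + (of_nat N - of_nat n) * (1 - ?u)"
    using nz(1) by (simp add: distrib_left distrib_right)
  also have "\<dots> = ?u * (z * (1 - ?v1) * (1 - ?u) - (\<mu> + of_nat N + of_nat n + 1))"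
    using U_relation[OF n(1) Suc.prems(2)] by (simp add: algebra_simps)
  finally have R: "(z * ?v + (of_nat N - of_nat n) / ?u) * (1 - ?u) =
      z * (1 - ?v1) * (1 - ?u) - (\<mu> + of_nat N + of_nat n + 1)"
    using nz(1) by simp
  have "of_nat N * P (Suc n) * (?u1 * (1 - ?v1)) = (of_nat N * P n) * (1 - ?u) * ?v1 + of_nat N"
    using arg_cong[OF P, of "\<lambda>x. of_nat N * x"] by (simp add: algebra_simps)
  also have "\<dots> = (z * (1 - ?v1) * (1 - ?u) - (\<mu> + of_nat N + of_nat n + 1)) * ?v1 + of_nat N"
    unfolding IH R ..
  also have "\<dots> = z * ?v1 * (?u1 * (1 - ?v1)) + (of_nat N - of_nat (Suc n)) * (1 - ?v1)"
    using V_relation[OF Suc.prems] by (simp add: algebra_simps)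
  also have "\<dots> = (z * ?v1 + (of_nat N - of_nat (Suc n)) / ?u1) * (?u1 * (1 - ?v1))"
    using nz(3) by (simp add: distrib_right)
  finally have "of_nat N * P (Suc n) = z * ?v1 + (of_nat N - of_nat (Suc n)) / ?u1"
    by (subst (asm) mult_right_cancel) (use nz in simp_all)
  then show ?case by (simp add: P_def)
qed

text \<open>The counterpart of \<open>tau_20_eq\<close> for case (iv), with \<open>x - 1\<close> in
  place of \<open>x\<close> and \<open>1 - U n\<close> in place of \<open>U n\<close>.\<close>

lemma tau_02_eq:
  assumes "n < N" "z \<in> S"
  shows "- (\<mu> + of_nat N + 1) * (poly (tau 0 0 (Suc n)) z * poly (tau 0 2 n) z / (poly (tau 0 1 n) z * poly (tau 0 1 (Suc n)) z)) =
    z * V n z + (\<mu> + of_nat N + of_nat n + 1) / (1 - U n z)"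
  using assms
proof (induction n)
  case 0
  then have "poly (tau 0 0 (Suc 0)) z \<noteq> 0" "poly (tau 0 1 (Suc 0)) z \<noteq> 0" by (simp_all add: S_nonzero(2))
  then show ?case unfolding one_minus_U[OF 0(2,1)] by (simp add: V_def field_simps)
next
  case (Suc n)
  define P where "P k = poly (tau 0 0 (Suc k)) z * poly (tau 0 2 k) z / (poly (tau 0 1 k) z * poly (tau 0 1 (Suc k)) z)" for k
  let ?u = "U n z" and ?u1 = "U (Suc n) z" and ?v = "V n z" and ?v1 = "V (Suc n) z"
  define k where "k = \<mu> + of_nat N + of_nat n + 1"
  define c where "c = \<mu> + of_nat N + 1"
  have n: "n < N" "n < N - 1" using Suc.prems by auto
  have nz: "?u \<noteq> 0" "1 - ?u \<noteq> 0" "1 - ?u1 \<noteq> 0" "1 - ?v1 \<noteq> 0"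
    using U_nontrivial[of z n] U_nontrivial[of z "Suc n"] Suc.prems n by auto
  have sn: "poly (tau 0 0 (Suc n)) z \<noteq> 0" "poly (tau 0 0 (Suc (Suc n))) z \<noteq> 0" "poly (tau 0 1 n) z \<noteq> 0"
     "poly (tau 0 1 (Suc n)) z \<noteq> 0" "poly (tau 0 1 (Suc (Suc n))) z \<noteq> 0" "poly (tau 1 0 (Suc n)) z \<noteq> 0"
     "poly (tau 1 1 (Suc n)) z \<noteq> 0" "poly (tau 1 1 n) z \<noteq> 0"
    using Suc.prems by (simp_all add: S_nonzero(2))
  have "P n * (?u * ?v1) = - (poly (tau 0 0 (Suc (Suc n)) * tau 0 2 n) z / (poly (tau 0 1 (Suc n)) z * poly (tau 0 1 (Suc n)) z))"
    unfolding U_V_factors(3)[OF Suc.prems] P_def using sn by (simp add: field_simps)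
  also have "\<dots> = 1 - poly (tau 0 0 (Suc n)) z * poly (tau 0 2 (Suc n)) z / (poly (tau 0 1 (Suc n)) z * poly (tau 0 1 (Suc n)) z)"
    unfolding tau_desnanot_jacobi(3)[OF n(1)] using sn by (simp add: diff_divide_distrib)
  also have "\<dots> = 1 + P (Suc n) * ((1 - ?u1) * (1 - ?v1))"
    unfolding U_V_factors(4)[OF Suc.prems] P_def using sn by (simp add: field_simps)
  finally have P: "P (Suc n) * ((1 - ?u1) * (1 - ?v1)) = P n * (?u * ?v1) - 1" by simp
  have IH: "- c * P n = z * ?v + k / (1 - ?u)"
    using Suc.IH n Suc.prems by (simp add: P_def c_def k_def)
  have "(1 - ?u) * ((z * ?v + k / (1 - ?u)) * ?u) =
      z * ?v * ?u * (1 - ?u) + k * ?u"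
    using nz(2) by (simp add: distrib_left distrib_right)
  also have "\<dots> = (1 - ?u) * (z * ?u * (1 - ?v1) - (of_nat N - of_nat n))"
    using U_relation[OF n(1) Suc.prems(2)] by (simp add: algebra_simps k_def)
  finally have R: "(z * ?v + k / (1 - ?u)) * ?u =
      z * ?u * (1 - ?v1) - (of_nat N - of_nat n)"
    using nz(2) by simp
  have "- c * P (Suc n) * ((1 - ?u1) * (1 - ?v1)) = - c * (P (Suc n) * ((1 - ?u1) * (1 - ?v1)))"
    by (simp only: mult.assoc)
  also have "\<dots> = (- c * P n) * ?u * ?v1 + c"
    unfolding P by (simp add: algebra_simps)
  also have "\<dots> = (z * ?u * (1 - ?v1) - (of_nat N - of_nat n)) * ?v1 + c"
    unfolding IH R ..
  also have "\<dots> = z * ?v1 * ((1 - ?u1) * (1 - ?v1)) + (\<mu> + of_nat N + of_nat (Suc n) + 1) * (1 - ?v1)"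
    using V_relation[OF Suc.prems] by (simp add: algebra_simps c_def k_def)
  also have "\<dots> = (z * ?v1 + (\<mu> + of_nat N + of_nat (Suc n) + 1) / (1 - ?u1)) * ((1 - ?u1) * (1 - ?v1))"
  proof -
    have "K / (1 - ?u1) * ((1 - ?u1) * (1 - ?v1)) = K * (1 - ?v1)" for K using nz(3) by simp
    then show ?thesis by (simp only: distrib_right)
  qed
  finally have "- c * P (Suc n) = z * ?v1 + (\<mu> + of_nat N + of_nat (Suc n) + 1) / (1 - ?u1)"
    by (subst (asm) mult_right_cancel) (use nz in simp_all)
  then show ?case by (simp add: P_def c_def)
qed

text \<open>For \<open>n = 0\<close> this is the Laguerre equation divided by \<open>z f'\<close>.
  In the step, the second ratio of consecutive \<open>tau 1 0\<close> is the product of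
  \<open>U (Suc n)\<close>, \<open>1 - U n\<close>, \<open>V (Suc n)\<close> and
  \<open>1 - V (Suc n)\<close>, and its logarithmic derivative is the increment of the left
  side.\<close>

lemma pderiv_log_tau_10:
  assumes "n < N" "z \<in> S"
  shows "pderiv_log (tau 1 0 (Suc n)) z - pderiv_log (tau 1 0 n) z =
    1 - (\<mu> + 2 * of_nat n + 1) / z - V n z - (of_nat N - of_nat n) / (z * U n z)"
  using assms
proof (induction n)
  case 0
  have fz: "poly f z \<noteq> 0" and z: "z \<noteq> 0" and gz: "poly (pderiv f) z \<noteq> 0"
    using S_nonzero(2)[OF 0(2), of 0 0 1] S_nonzero(2)[OF 0(2), of 1 0 1] S_nonzero(1)[OF 0(2)] 0 by (simp_all add: tau_def)
  have "z * poly (pderiv (pderiv f)) z = (z - (\<mu> + 1)) * poly (pderiv f) z - of_nat N * poly f z"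
    using laguerre_equation[of z] by (simp add: algebra_simps eq_neg_iff_add_eq_0)
  then have "z * poly (pderiv (pderiv f)) z / (z * poly (pderiv f) z) =
    ((z - (\<mu> + 1)) * poly (pderiv f) z - of_nat N * poly f z) / (z * poly (pderiv f) z)" by simp
  then have "poly (pderiv (pderiv f)) z / poly (pderiv f) z =
      1 - (\<mu> + 1) / z - of_nat N * poly f z / (z * poly (pderiv f) z)"
    using z gz by (simp add: diff_divide_distrib)
  then show ?case by (simp add: tau_def U_def V_def)
next
  case (Suc n)
  let ?u = "U n z" and ?u1 = "U (Suc n) z" and ?v = "V n z" and ?v1 = "V (Suc n) z" and ?v2 = "V (Suc (Suc n)) z"
  have n: "n < N" "Suc n < N" using Suc.prems by auto
  have z: "z \<noteq> 0" using Suc.prems by (simp add: S_nonzero(1))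
  have nz: "?u \<noteq> 0" "1 - ?u \<noteq> 0" "?u1 \<noteq> 0" "1 - ?u1 \<noteq> 0" "?v1 \<noteq> 0" "1 - ?v1 \<noteq> 0"
    using U_nontrivial[OF Suc.prems(2) n(1)] U_nontrivial[OF Suc.prems(2) n(2)] by auto
  have product: "U (Suc n) w * (1 - U n w) * V (Suc n) w * (1 - V (Suc n) w) =
      poly (tau 1 0 (Suc (Suc n))) w * poly (tau 1 0 n) w / (poly (tau 1 0 (Suc n)) w * poly (tau 1 0 (Suc n)) w)"
    if "w \<in> S" for w
  proof -
    have "U (Suc n) w * (1 - U n w) * V (Suc n) w * (1 - V (Suc n) w) =
        ((1 - U n w) * V (Suc n) w) * (U (Suc n) w * (1 - V (Suc n) w))" by (simp only: mult_ac)
    moreover have "poly (tau 0 0 (Suc n)) w \<noteq> 0" "poly (tau 0 0 (Suc (Suc n))) w \<noteq> 0"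
      using that Suc.prems by (simp_all add: S_nonzero(2))
    ultimately show ?thesis
      unfolding U_V_factors(1,2)[OF Suc.prems(1) that] by (simp add: mult_ac)
  qed
  \<comment> \<open>\<open>d\<close> and \<open>e\<close> are the same logarithmic derivative,
    computed once from the determinants and once from the Toda equations.\<close>
  define d where "d = pderiv_log (tau 1 0 (Suc (Suc n))) z + pderiv_log (tau 1 0 n) z
      - pderiv_log (tau 1 0 (Suc n)) z - pderiv_log (tau 1 0 (Suc n)) z"
  define e where "e = (1 - ?u1) * (?v2 - ?v1) - ?u * (?v1 - ?v) + (1 - 2 * ?v1) * (?u1 - ?u)"
  define p where "p w = U (Suc n) w * (1 - U n w) * V (Suc n) w * (1 - V (Suc n) w)" for w
  have "poly (tau 1 0 (Suc (Suc n))) z \<noteq> 0" "poly (tau 1 0 n) z \<noteq> 0" "poly (tau 1 0 (Suc n)) z \<noteq> 0"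
    using Suc.prems by (simp_all add: S_nonzero(2))
  from DERIV_poly_product_quotient[OF this(1,2,3,3), folded d_def]
  have "(p has_field_derivative p z * d) (at z)"
    unfolding p_def product[OF Suc.prems(2)]
    by (rule has_field_derivative_transform_within_open[OF _ open_S Suc.prems(2)]) (simp only: product)
  moreover have "(p has_field_derivative p z * e) (at z)"
    unfolding p_def e_def
    by (rule derivative_eq_intros DERIV_U DERIV_V Suc.prems n refl | simp add: algebra_simps)+
  ultimately have "p z * d = p z * e" by (rule DERIV_unique)
  moreover have "p z \<noteq> 0" using nz by (simp add: p_def)
  ultimately have de: "d = e" by simp
  \<comment> \<open>Naming the terms with denominators makes the rest polynomial: \<open>R\<close>
    and \<open>R1\<close> solve \<open>U_relation\<close> for \<open>V n\<close> and
    \<open>V (Suc (Suc n))\<close>, and \<open>ab\<close> reduces the products that arise.\<close>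
  define i where "i = 1 / z"
  define m where "m = (of_nat N - of_nat n :: complex)"
  define k where "k = \<mu> + of_nat N + of_nat n + 1"
  define a where "a = m / (z * ?u)"
  define a1 where "a1 = (m - 1) / (z * ?u1)"
  define b where "b = k / (z * (1 - ?u))"
  define b1 where "b1 = (k + 1) / (z * (1 - ?u1))"
  have za: "z * ?u * a = m" "z * (1 - ?u) * b = k" "z * ?u1 * a1 = m - 1" "z * (1 - ?u1) * b1 = k + 1"
    using nz z unfolding a_def a1_def b_def b1_def by (simp_all only: nonzero_mult_divide_mult_cancel_left
      times_divide_eq_right nonzero_mult_div_cancel_left mult_eq_0_iff simp_thms)
  have ab: "?u * a = m * i" "?u * b = b - k * i" "?u1 * a1 = m * i - i" "?u1 * b1 = b1 - k * i - i"
  proof -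
    have "x = y * i" if "z * x = y" for x y using that z by (auto simp: i_def)
    from this[of "?u * a" m] this[of "(1 - ?u) * b" k] this[of "?u1 * a1" "m - 1"] this[of "(1 - ?u1) * b1" "k + 1"]
    show "?u * a = m * i" "?u * b = b - k * i" "?u1 * a1 = m * i - i" "?u1 * b1 = b1 - k * i - i"
      using za by (simp_all add: algebra_simps)
  qed
  have R: "?v = 1 - a - b - ?v1"
  proof -
    have "z * ?u * (1 - ?u) * (?v - (1 - a - b - ?v1)) =
        (z * ?u * (1 - ?u) * (?v1 + ?v - 1) + m * (1 - ?u) + k * ?u) +
        (1 - ?u) * (z * ?u * a - m) + ?u * (z * (1 - ?u) * b - k)"
      by (simp add: algebra_simps)
    also have "\<dots> = 0"
      using U_relation[OF n(1) Suc.prems(2)] za by (simp add: m_def k_def)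
    finally show ?thesis using z nz by simp
  qed
  have R1: "?v2 = 1 - a1 - b1 - ?v1"
  proof -
    have "z * ?u1 * (1 - ?u1) * (?v2 - (1 - a1 - b1 - ?v1)) =
        (z * ?u1 * (1 - ?u1) * (?v2 + ?v1 - 1) + (m - 1) * (1 - ?u1) + (k + 1) * ?u1) +
        (1 - ?u1) * (z * ?u1 * a1 - (m - 1)) + ?u1 * (z * (1 - ?u1) * b1 - (k + 1))"
      by (simp add: algebra_simps)
    also have "z * ?u1 * (1 - ?u1) * (?v2 + ?v1 - 1) + (m - 1) * (1 - ?u1) + (k + 1) * ?u1 = 0"
      using U_relation[OF n(2) Suc.prems(2)] by (simp add: m_def k_def algebra_simps)
    finally show ?thesis using z nz za by simp
  qed
  have e: "e = - (2 * i) - ?v1 - a1 + ?v + a"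
    unfolding e_def R R1 by (simp add: algebra_simps ab ab[unfolded mult.commute[of "U _ z"]])
  have IH: "pderiv_log (tau 1 0 (Suc n)) z - pderiv_log (tau 1 0 n) z = 1 - (\<mu> + 2 * of_nat n + 1) / z - ?v - a"
    using Suc.IH n Suc.prems by (simp add: a_def m_def)
  have "pderiv_log (tau 1 0 (Suc (Suc n))) z - pderiv_log (tau 1 0 (Suc n)) z =
      d + (pderiv_log (tau 1 0 (Suc n)) z - pderiv_log (tau 1 0 n) z)"
    by (simp add: d_def)
  also have "\<dots> = 1 - (\<mu> + 2 * of_nat (Suc n) + 1) / z - ?v1 - a1"
    unfolding de e IH using z by (simp add: i_def field_simps)
  finally show ?case by (simp add: a1_def m_def diff_diff_eq add.commute)
qed

end

section \<open>Symmetries of the system and extension by continuity\<close>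

text \<open>Conjugation with this symmetry turns \<open>PV_reflection\<close> from a reflection of
  the first parameter of \<open>x\<close> into one of the second.\<close>

lemma PV_equation_flip:
  assumes "PV_equation a b x y z" "x field_differentiable at z"
  shows "PV_equation b a (\<lambda>w. 1 - x w) (\<lambda>w. 1 - y w) z"
proof -
  have "deriv (\<lambda>w. 1 - x w) z = - deriv x z"
    using assms(2) by (simp add: deriv_diff)
  then show ?thesis using assms(1) by (simp add: PV_equation_def algebra_simps)
qed

lemma PV_equation_cong:
  assumes "open S" "z \<in> S" "\<And>w. w \<in> S \<Longrightarrow> x w = x' w" "\<And>w. w \<in> S \<Longrightarrow> y w = y' w"
  shows "PV_equation a b x y z \<longleftrightarrow> PV_equation a b x' y' z"
proof -
  have "deriv x z = deriv x' z"
    by (rule deriv_cong_ev) (use assms in \<open>auto simp: eventually_nhds intro!: exI[of _ S]\<close>)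
  then show ?thesis using assms by (simp add: PV_equation_def)
qed

text \<open>A simple reflection of the affine Weyl group of type A3: \<open>p\<close> changes sign
  and is added to its neighbours \<open>r\<close> and \<open>t\<close>. Substituting
  \<open>y = y' + p / (z x)\<close> into the equation of \<open>x\<close> merely flips the sign of
  \<open>p\<close>; the equation of \<open>y'\<close> follows by differentiating the shift.\<close>

lemma PV_reflection:
  fixes x y :: "complex \<Rightarrow> complex" and p :: complex
  defines "y' \<equiv> \<lambda>w. y w - p / (w * x w)"
  assumes x: "x field_differentiable at z" and y: "y field_differentiable at z"
    and nz: "z \<noteq> 0" "x z \<noteq> 0"
    and eq_x: "PV_equation p q x y z" and eq_y: "PV_equation r t y (\<lambda>w. 1 - x w) z"
    and sum: "p + q + r + t = 1"
  shows "PV_equation (- p) q x y' z" "PV_equation (r + p) (t + p) y' (\<lambda>w. 1 - x w) z"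
proof -
  define a where "a = p / (z * x z)"
  have p: "p = z * x z * a" using nz by (simp add: a_def)
  have y'z: "y' z = y z - a" by (simp add: y'_def a_def)
  have "x z * (z * deriv y' z) = x z * (z * deriv y z) + a * x z + a * (z * deriv x z)"
  proof -
    have "(y' has_field_derivative deriv y z + p * (x z + z * deriv x z) / (z * x z)\<^sup>2) (at z)"
      unfolding y'_def
      by (rule derivative_eq_intros refl x[THEN field_differentiable_derivI] y[THEN field_differentiable_derivI]
          | use nz in \<open>simp add: power2_eq_square divide_simps\<close> | simp add: algebra_simps)+
    then have "deriv y' z = deriv y z + p * (x z + z * deriv x z) / (z * x z)\<^sup>2"
      by (rule DERIV_imp_deriv)
    then show ?thesis using nz unfolding a_def
      by (simp add: divide_simps power2_eq_square) (simp add: algebra_simps)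
  qed
  also have "a * (z * deriv x z) = a * (z * (2 * y z - 1) * x z * (x z - 1) + p * (1 - x z) - q * x z)"
    using eq_x by (simp add: PV_equation_def)
  also have "\<dots> = x z * (a * (z * (2 * y z - 1) * (x z - 1) + z * a * (1 - x z) - q))"
    unfolding p by (simp add: algebra_simps)
  finally have "x z * (z * deriv y' z) =
      x z * (z * deriv y z + a + a * (z * (2 * y z - 1) * (x z - 1) + z * a * (1 - x z) - q))"
    by (simp add: algebra_simps)
  then have "z * deriv y' z = z * deriv y z + a + a * (z * (2 * y z - 1) * (x z - 1) + z * a * (1 - x z) - q)"
    using nz by simp
  moreover have "z * deriv y z = z * (1 - 2 * x z) * y z * (y z - 1) + r * (1 - y z) - t * y z"
    using eq_y by (simp add: PV_equation_def algebra_simps)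
  moreover have "q = 1 - r - t - z * x z * a" using sum p by (simp add: algebra_simps)
  ultimately show "PV_equation (r + p) (t + p) y' (\<lambda>w. 1 - x w) z"
    unfolding PV_equation_def y'z p by (simp add: algebra_simps)
  show "PV_equation (- p) q x y' z"
    using eq_x unfolding PV_equation_def y'z p by (simp add: algebra_simps)
qed

text \<open>Every point is a limit point of a set with finite complement, so both values are limits
  of the same function.\<close>

lemma isCont_eq_cofinite:
  fixes F G :: "complex \<Rightarrow> complex"
  assumes "isCont F z" "isCont G z" "finite (- S)" "\<And>w. w \<in> S \<Longrightarrow> F w = G w"
  shows "F z = G z"
proof -
  have "eventually (\<lambda>w. w \<notin> - S) (at z)"
    using assms(3) islimpt_finite islimpt_iff_eventually by blast
  then have "eventually (\<lambda>w. F w = G w) (at z)"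
    by eventually_elim (use assms(4) in auto)
  then have "(F \<longlongrightarrow> G z) (at z)"
    using assms(2) by (simp add: isCont_def tendsto_cong)
  then show ?thesis
    using assms(1) tendsto_unique[of "at z" F] by (simp add: isCont_def)
qed

text \<open>On \<open>D\<close> both sides of each equation are continuous, because \<open>u\<close>
  and \<open>v\<close> are quotients with nonvanishing denominators. Equality therefore extends from
  the cofinite set \<open>S\<close> to the points of \<open>D\<close> outside it.\<close>

lemma rational_PV_solution_onI:
  fixes pu qu pv qv :: "complex poly"
  assumes D: "finite (- D)" "\<And>z. z \<in> D \<Longrightarrow> poly qu z \<noteq> 0 \<and> poly qv z \<noteq> 0"
    and u: "\<And>z. u z = poly pu z / poly qu z" and v: "\<And>z. v z = poly pv z / poly qv z"
    and sum: "\<kappa>1 + \<kappa>2 + \<kappa>3 + \<kappa>4 = 1"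
    and S: "finite (- S)"
    and eq_u: "\<And>z. z \<in> S \<Longrightarrow> PV_equation \<kappa>1 \<kappa>3 u v z"
    and eq_v: "\<And>z. z \<in> S \<Longrightarrow> PV_equation \<kappa>2 \<kappa>4 v (\<lambda>w. 1 - u w) z"
  shows "rational_PV_solution_on D (\<kappa>1, \<kappa>2, \<kappa>3, \<kappa>4) u v"
proof -
  \<comment> \<open>The derivative as an explicit rational function, whose continuity is evident, in
    contrast to that of \<open>deriv u\<close>.\<close>
  define q where "q = (\<lambda>p q z. (poly (pderiv p) z * poly q z - poly p z * poly (pderiv q) z) / (poly q z * poly q z :: complex))"
  have q: "((\<lambda>z. poly a z / poly b z) has_field_derivative q a b z) (at z)" if "poly b z \<noteq> 0" for a b z
    unfolding q_def by (rule derivative_eq_intros poly_DERIV refl that)+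
  have cont: "isCont (q a b) z" "isCont (\<lambda>z. poly a z / poly b z) z" if "poly b z \<noteq> 0" for a b z
    unfolding q_def[abs_def] using that by (auto intro!: continuous_intros)
  have du: "(u has_field_derivative q pu qu z) (at z)" and dv: "(v has_field_derivative q pv qv z) (at z)"
    if "z \<in> D" for z
    using q[of qu z pu] q[of qv z pv] D(2)[OF that] unfolding u[abs_def] v[abs_def] by auto
  have cu: "isCont u z" "isCont (q pu qu) z" and cv: "isCont v z" "isCont (q pv qv) z" if "z \<in> D" for z
    using cont[of qu z pu] cont[of qv z pv] D(2)[OF that] unfolding u[abs_def] v[abs_def] by auto
  have fin: "finite (- (S \<inter> D))" using S D(1) by (simp add: Compl_Int)
  have "PV_equation \<kappa>1 \<kappa>3 u v z" if z: "z \<in> D" for z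
  proof -
    have "w * q pu qu w = w * (2 * v w - 1) * u w * (u w - 1) + \<kappa>1 * (1 - u w) - \<kappa>3 * u w"
      if "w \<in> S \<inter> D" for w
      using eq_u[of w] DERIV_imp_deriv[OF du[of w]] that by (simp add: PV_equation_def)
    then have "z * q pu qu z = z * (2 * v z - 1) * u z * (u z - 1) + \<kappa>1 * (1 - u z) - \<kappa>3 * u z"
      by (rule isCont_eq_cofinite[OF _ _ fin, rotated 2]) (use z cu cv in \<open>auto intro!: continuous_intros\<close>)
    then show ?thesis using DERIV_imp_deriv[OF du[OF z]] by (simp add: PV_equation_def)
  qed
  moreover have "PV_equation \<kappa>2 \<kappa>4 v (\<lambda>w. 1 - u w) z" if z: "z \<in> D" for z
  proof -
    have "w * q pv qv w = w * (2 * (1 - u w) - 1) * v w * (v w - 1) + \<kappa>2 * (1 - v w) - \<kappa>4 * v w"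
      if "w \<in> S \<inter> D" for w
      using eq_v[of w] DERIV_imp_deriv[OF dv[of w]] that by (simp add: PV_equation_def)
    then have "z * q pv qv z = z * (2 * (1 - u z) - 1) * v z * (v z - 1) + \<kappa>2 * (1 - v z) - \<kappa>4 * v z"
      by (rule isCont_eq_cofinite[OF _ _ fin, rotated 2]) (use z cu cv in \<open>auto intro!: continuous_intros\<close>)
    then show ?thesis using DERIV_imp_deriv[OF dv[OF z]] by (simp add: PV_equation_def)
  qed
  moreover have "rational_function_on D u" "rational_function_on D v"
    unfolding rational_function_on_def using D u v by blast+
  moreover have "u field_differentiable at z" "v field_differentiable at z" if "z \<in> D" for z
    using du dv that unfolding field_differentiable_def by blast+
  ultimately show ?thesis
    using sum unfolding rational_PV_solution_on_def PV_equation_def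
    by (auto simp: power2_eq_square algebra_simps)
qed

lemma log_deriv_poly_quotient:
  assumes "poly p z \<noteq> 0" "poly q z \<noteq> 0"
  shows "log_deriv (\<lambda>z. poly p z / poly q z) z = pderiv_log p z - pderiv_log q z"
proof -
  have "((\<lambda>z. poly p z / poly q z) has_field_derivative
      (poly (pderiv p) z * poly q z - poly p z * poly (pderiv q) z) / (poly q z * poly q z)) (at z)"
    by (rule derivative_eq_intros poly_DERIV refl assms)+
  then show ?thesis
    using assms by (simp add: log_deriv_def DERIV_imp_deriv diff_frac_eq mult.commute)
qed

lemma pderiv_log_uminus: "pderiv_log ((-1) ^ k * p) z = pderiv_log p z"
  by (cases "even k") (simp_all add: pderiv_minus)

section \<open>Laguerre polynomials\<close>

lemma coeff_laguerre_poly: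
  "coeff (laguerre_poly n \<alpha>) i = (if i \<le> n then
    (-1) ^ i / (fact i * fact (n - i)) * (\<Prod>l\<in>{i+1..n}. \<alpha> + of_nat l) else 0)"
  by (simp add: laguerre_poly_def coeff_sum)

text \<open>The product in the leading coefficient is empty, so this coefficient is nonzero for
  every complex \<alpha>.\<close>

lemma degree_laguerre_poly: "degree (laguerre_poly n \<alpha>) = n"
  and laguerre_poly_nonzero: "laguerre_poly n \<alpha> \<noteq> 0"
proof -
  have "coeff (laguerre_poly n \<alpha>) n \<noteq> 0" by (simp add: coeff_laguerre_poly)
  moreover have "degree (laguerre_poly n \<alpha>) \<le> n" by (rule degree_le) (simp add: coeff_laguerre_poly)
  ultimately show "degree (laguerre_poly n \<alpha>) = n" "laguerre_poly n \<alpha> \<noteq> 0"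
    using le_degree[of "laguerre_poly n \<alpha>" n] by (auto simp: le_antisym)
qed

lemma pderiv_laguerre_poly: "pderiv (laguerre_poly (Suc n) \<alpha>) = - laguerre_poly n (\<alpha> + 1)"
proof (rule poly_eqI)
  fix i
  have "(\<Prod>l = Suc (Suc i)..Suc n. \<alpha> + of_nat l) = (\<Prod>l = Suc i..n. \<alpha> + 1 + of_nat l)"
    unfolding prod.shift_bounds_cl_Suc_ivl by (simp add: add_ac)
  then show "coeff (pderiv (laguerre_poly (Suc n) \<alpha>)) i = coeff (- laguerre_poly n (\<alpha> + 1)) i"
    by (simp add: coeff_pderiv coeff_laguerre_poly field_simps del: of_nat_Suc)
qed

lemma binomial_coefficient_recurrence:
  fixes c :: "nat \<Rightarrow> complex" and n :: nat
  defines "c \<equiv> \<lambda>i. (-1) ^ i / (fact i * fact (n - i))"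
  assumes "i < n"
  shows "of_nat (Suc i) * c (Suc i) = (of_nat i - of_nat n) * c i"
proof -
  obtain k where n: "n = Suc (i + k)" using assms(2) by (metis less_imp_Suc_add)
  have "(of_nat i - of_nat n :: complex) = - of_nat (Suc k)" by (simp add: n)
  moreover have "n - i = Suc k" "n - Suc i = k" by (simp_all add: n)
  ultimately show ?thesis by (simp add: c_def del: of_nat_Suc)
qed

text \<open>In the coefficient of \<open>z^i\<close> the recurrence of \<open>c\<close> leaves the
  factor \<open>(i - n) - (\<alpha> + i + 1) = - (\<alpha> + 1 + n)\<close>, whose negative is the
  last factor of the product for \<open>\<alpha> + 1\<close>.\<close>

lemma shifted_pderiv_laguerre_poly:
  "shifted_pderiv 1 (laguerre_poly n \<alpha>) = - laguerre_poly n (\<alpha> + 1)"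
proof (rule poly_eqI)
  fix i
  define c :: "nat \<Rightarrow> complex" where "c i = (-1) ^ i / (fact i * fact (n - i))" for i
  define P where "P = (\<Prod>l = Suc (Suc i)..n. \<alpha> + of_nat l)"
  consider "i < n" | "i = n" | "n < i" by linarith
  then show "coeff (shifted_pderiv 1 (laguerre_poly n \<alpha>)) i = coeff (- laguerre_poly n (\<alpha> + 1)) i"
  proof cases
    case 1
    then obtain k where n: "n = Suc (i + k)" by (metis less_imp_Suc_add)
    have P1: "(\<Prod>l = Suc i..n. \<alpha> + of_nat l) = (\<alpha> + of_nat (Suc i)) * P"
      using 1 by (simp add: P_def prod.atLeast_Suc_atMost)
    have P2: "(\<Prod>l = Suc i..n. \<alpha> + 1 + of_nat l) = P * (\<alpha> + 1 + of_nat n)"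
    proof -
      have "P = (\<Prod>l = Suc i..i + k. \<alpha> + 1 + of_nat l)"
        unfolding P_def n prod.shift_bounds_cl_Suc_ivl by (simp add: add_ac)
      then show ?thesis unfolding n by simp
    qed
    have "coeff (shifted_pderiv 1 (laguerre_poly n \<alpha>)) i =
        (of_nat (Suc i) * c (Suc i)) * P - c i * ((\<alpha> + of_nat (Suc i)) * P)"
      using 1 by (simp add: shifted_pderiv_def coeff_pderiv coeff_laguerre_poly c_def P_def P1[unfolded P_def] del: of_nat_Suc)
    also have "of_nat (Suc i) * c (Suc i) = (of_nat i - of_nat n) * c i"
      unfolding c_def by (rule binomial_coefficient_recurrence[OF 1])
    also have "(of_nat i - of_nat n) * c i * P - c i * ((\<alpha> + of_nat (Suc i)) * P) = - (c i * (P * (\<alpha> + 1 + of_nat n)))"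
      by (simp add: algebra_simps)
    also have "\<dots> = coeff (- laguerre_poly n (\<alpha> + 1)) i"
      using 1 by (simp add: coeff_laguerre_poly c_def P2)
    finally show ?thesis .
  qed (simp_all add: shifted_pderiv_def coeff_pderiv coeff_laguerre_poly)
qed

text \<open>Comparison of coefficients reduces the equation to the two-term recurrence
  \<open>rec\<close>, which persists at \<open>i = n\<close>, where the factor \<open>n - i\<close>
  vanishes, and beyond the degree.\<close>

lemma laguerre_poly_equation:
  "z * poly (pderiv (pderiv (laguerre_poly n \<alpha>))) z + (\<alpha> + 1 - z) * poly (pderiv (laguerre_poly n \<alpha>)) z +
    of_nat n * poly (laguerre_poly n \<alpha>) z = 0"
proof -
  let ?L = "laguerre_poly n \<alpha>"
  have "pCons 0 (pderiv (pderiv ?L)) + Polynomial.smult (\<alpha> + 1) (pderiv ?L) - pCons 0 (pderiv ?L) +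
      Polynomial.smult (of_nat n) ?L = 0"
  proof (rule poly_eqI)
    fix i
    define c :: "nat \<Rightarrow> complex" where "c i = (-1) ^ i / (fact i * fact (n - i))" for i
    have rec: "of_nat (Suc i) * (of_nat (Suc i) + \<alpha>) * coeff ?L (Suc i) + (of_nat n - of_nat i) * coeff ?L i = 0"
    proof -
      consider "i < n" | "i = n" | "n < i" by linarith
      then show ?thesis
      proof cases
        case 1
        define P where "P = (\<Prod>l = Suc (Suc i)..n. \<alpha> + of_nat l)"
        have c1: "coeff ?L (Suc i) = c (Suc i) * P"
          using 1 by (simp add: coeff_laguerre_poly c_def P_def)
        have c2: "coeff ?L i = c i * ((\<alpha> + of_nat (Suc i)) * P)"
          using 1 by (simp add: coeff_laguerre_poly c_def P_def prod.atLeast_Suc_atMost)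
        have c3: "of_nat (Suc i) * c (Suc i) = (of_nat i - of_nat n) * c i"
          unfolding c_def by (rule binomial_coefficient_recurrence[OF 1])
        have "of_nat (Suc i) * (of_nat (Suc i) + \<alpha>) * coeff ?L (Suc i) + (of_nat n - of_nat i) * coeff ?L i
            = (of_nat (Suc i) * c (Suc i) - (of_nat i - of_nat n) * c i) * ((of_nat (Suc i) + \<alpha>) * P)"
          unfolding c1 c2 by (simp add: algebra_simps del: of_nat_Suc)
        then show ?thesis unfolding c3 by simp
      qed (simp_all add: coeff_laguerre_poly)
    qed
    show "coeff (pCons 0 (pderiv (pderiv ?L)) + Polynomial.smult (\<alpha> + 1) (pderiv ?L) - pCons 0 (pderiv ?L) +
      Polynomial.smult (of_nat n) ?L) i = coeff 0 i"
      using rec by (cases i) (simp_all add: coeff_pderiv algebra_simps)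
  qed
  from arg_cong[OF this, of "\<lambda>p. poly p z"] show ?thesis by (simp add: algebra_simps)
qed

lemma laguerre_chain_laguerre_poly: "laguerre_chain (laguerre_poly N \<mu>) N \<mu>"
  by unfold_locales (simp_all add: laguerre_poly_nonzero degree_laguerre_poly laguerre_poly_equation)

lemma shifted_pderivs_laguerre_poly:
  assumes "i \<le> N"
  shows "(shifted_pderiv 0 ^^ i) ((shifted_pderiv 1 ^^ j) (laguerre_poly N \<alpha>)) =
    (-1) ^ (i + j) * laguerre_poly (N - i) (\<alpha> + of_nat i + of_nat j)"
proof -
  have minus: "shifted_pderiv c (- p) = - shifted_pderiv c p" for c and p :: "complex poly"
    by (simp add: shifted_pderiv_def pderiv_minus)
  have sign: "shifted_pderiv c ((-1) ^ k * p) = (-1) ^ k * shifted_pderiv c p" for c k and p :: "complex poly"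
    by (cases "even k") (simp_all add: minus)
  have "(shifted_pderiv 1 ^^ j) (laguerre_poly N \<alpha>) = (-1) ^ j * laguerre_poly N (\<alpha> + of_nat j)"
    by (induction j) (simp_all add: sign shifted_pderiv_laguerre_poly add_ac)
  moreover have "(shifted_pderiv 0 ^^ i) p = (-1) ^ (i + j) * laguerre_poly (N - i) (\<alpha> + of_nat i + of_nat j)"
    if "p = (-1) ^ j * laguerre_poly N (\<alpha> + of_nat j)" for p
    using assms
  proof (induction i)
    case (Suc i)
    then have "N - i = Suc (N - Suc i)" by simp
    then show ?case
      using Suc sign[of 0] by (simp add: pderiv_laguerre_poly add_ac)
  qed (simp add: that)
  ultimately show ?thesis by simp
qed

lemma hankel_wronskian_sign: "hankel_wronskian n ((-1) ^ k * f) = (-1) ^ (n * k) * hankel_wronskian n f"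
  by (cases "even k") (simp_all add: hankel_wronskian_uminus uminus_power_if)

lemma pderiv_log_quotient_extend:
  assumes "finite (- S)" "\<And>w. w \<in> S \<Longrightarrow> F w = c w + (pderiv_log p w - pderiv_log q w)"
    and "isCont F z" "isCont c z" "poly p z \<noteq> 0" "poly q z \<noteq> 0"
  shows "F z = c z + (pderiv_log p z - pderiv_log q z)"
  by (rule isCont_eq_cofinite[where G = "\<lambda>w. c w + (pderiv_log p w - pderiv_log q w)", OF _ _ assms(1,2)])
    (use assms(3-) in \<open>auto intro!: continuous_intros\<close>)

lemma log_deriv_signed_poly_quotient:
  assumes "poly p z \<noteq> 0" "poly q z \<noteq> 0"
  shows "log_deriv (\<lambda>z. (-1) ^ a * poly p z / ((-1) ^ b * poly q z)) z = pderiv_log p z - pderiv_log q z"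
proof -
  have "log_deriv (\<lambda>z. poly ((-1) ^ a * p) z / poly ((-1) ^ b * q) z) z =
      pderiv_log ((-1) ^ a * p) z - pderiv_log ((-1) ^ b * q) z"
    by (rule log_deriv_poly_quotient) (use assms in simp_all)
  then show ?thesis by (simp only: pderiv_log_uminus) (simp add: poly_power)
qed

section \<open>The four families in terms of the chain\<close>

context laguerre_chain
begin

text \<open>Each \<open>D\<close> lowers the degree of the Laguerre polynomial, and each
  \<open>D\<close> or \<open>D - 1\<close> raises its upper index and contributes a sign. The
  alternative \<open>n = 0\<close> covers \<open>i = 2\<close> with \<open>N = 1\<close>, where both
  determinants are empty.\<close>

lemma gen_laguerre_poly_eq_tau:
  assumes f: "f = laguerre_poly N \<mu>" and "n = 0 \<or> i \<le> N \<and> m + int n = int (N - i)"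
    and \<nu>: "\<nu> = \<mu> + of_nat i + of_nat j - 1"
  shows "gen_laguerre_poly m n \<nu> = (-1) ^ (n * (i + j)) * tau i j n"
proof (cases "n = 0")
  case True
  then show ?thesis by (simp add: gen_laguerre_poly_def)
next
  case False
  then have i: "i \<le> N" and mn: "m + int n = int (N - i)" using assms by auto
  have "tau i j n = hankel_wronskian n ((-1) ^ (i + j) * laguerre_poly (N - i) (\<mu> + of_nat i + of_nat j))"
    unfolding tau_def unfolding f by (simp only: shifted_pderivs_laguerre_poly[OF i])
  also have "\<dots> = (-1) ^ (n * (i + j)) * gen_laguerre_poly m n \<nu>"
    unfolding hankel_wronskian_sign using False \<nu> mn
    by (simp add: gen_laguerre_poly_def hankel_wronskian_def)
  finally show ?thesis
    by (simp add: mult.assoc[symmetric] power_add[symmetric] flip: mult_2)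
qed

definition U_dom :: "nat \<Rightarrow> complex set" where
  "U_dom n = {z. poly (tau 1 1 n) z \<noteq> 0 \<and> poly (tau 0 0 (Suc n)) z \<noteq> 0}"

text \<open>\<open>y\<close> expresses \<open>v\<close> through \<open>U\<close> and
  \<open>V\<close> and solves the system on \<open>S\<close>; the quotient of \<open>pv\<close> and
  \<open>qv\<close> carries the conclusion over to \<open>D\<close>.\<close>

lemma rational_PV_solution_U_I:
  fixes pv qv :: "complex poly"
  assumes n: "n < N" and D: "S \<subseteq> D" "\<And>z. z \<in> D \<Longrightarrow> poly qv z \<noteq> 0"
    and v: "\<And>z. v z = poly pv z / poly qv z"
    and sum: "\<kappa>1 + \<kappa>2 + \<kappa>3 + \<kappa>4 = 1"
    and y: "\<And>z. z \<in> S \<Longrightarrow> v z = y z"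
    and eq_u: "\<And>z. z \<in> S \<Longrightarrow> PV_equation \<kappa>1 \<kappa>3 (U n) y z"
    and eq_v: "\<And>z. z \<in> S \<Longrightarrow> PV_equation \<kappa>2 \<kappa>4 y (\<lambda>w. 1 - U n w) z"
  shows "rational_PV_solution_on (U_dom n \<inter> D) (\<kappa>1, \<kappa>2, \<kappa>3, \<kappa>4) (U n) v"
proof (rule rational_PV_solution_onI[OF _ _ _ v sum finite_compl_S])
  show "finite (- (U_dom n \<inter> D))"
    by (rule finite_subset[OF _ finite_compl_S]) (use D n in \<open>auto simp: U_dom_def S_nonzero(2)\<close>)
  show "U n z = poly (tau 0 1 n * tau 1 0 (Suc n)) z / poly (tau 1 1 n * tau 0 0 (Suc n)) z" for z
    by (simp add: U_def)
  show "PV_equation \<kappa>1 \<kappa>3 (U n) v z" "PV_equation \<kappa>2 \<kappa>4 v (\<lambda>w. 1 - U n w) z" if "z \<in> S" for z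
    using eq_u[OF that] eq_v[OF that] PV_equation_cong[OF open_S that y refl]
      PV_equation_cong[OF open_S that refl y] by simp_all
qed (use D in \<open>auto simp: U_dom_def\<close>)

lemma U_differentiable: "z \<in> S \<Longrightarrow> n < N \<Longrightarrow> U n field_differentiable at z"
  using DERIV_U by (auto simp: field_differentiable_def)

lemma U_log_deriv:
  assumes "n < N" "z \<in> U_dom n"
  shows "U n z = pderiv_log (tau 0 0 (Suc n)) z - pderiv_log (tau 1 1 n) z"
  using pderiv_log_quotient_extend[where c = "\<lambda>_. 0", OF finite_compl_S, of "U n" "tau 0 0 (Suc n)" "tau 1 1 n" z]
    assms U_eq_pderiv_log unfolding U_def[abs_def] U_dom_def by (simp add: continuous_intros)

text \<open>\<open>PV_reflection\<close> with \<open>p = of_nat n - of_nat N\<close> turns case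
  (iii) into the pair \<open>(U n, y)\<close>, and \<open>tau_20_eq\<close> identifies
  \<open>y\<close> with the determinant quotient.\<close>

lemma PV_solution_i:
  assumes n: "n < N"
  defines "D \<equiv> {z. z \<noteq> 0 \<and> poly (tau 1 0 n) z \<noteq> 0 \<and> poly (tau 1 0 (Suc n)) z \<noteq> 0}"
  defines "v \<equiv> \<lambda>z. of_nat N / z * (poly (tau 0 0 (Suc n)) z * poly (tau 2 0 n) z) / (poly (tau 1 0 n) z * poly (tau 1 0 (Suc n)) z)"
  shows "rational_PV_solution_on (U_dom n \<inter> D)
      (of_nat N - of_nat n, - of_nat N, \<mu> + of_nat N + of_nat n + 1, - of_nat N - \<mu>) (U n) v"
    and "z \<in> D \<Longrightarrow> v z = 1 - (\<mu> + 2 * of_nat n + 1) / z + (pderiv_log (tau 1 0 n) z - pderiv_log (tau 1 0 (Suc n)) z)"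
proof -
  define y where "y w = V n w - (of_nat n - of_nat N) / (w * U n w)" for w
  have vy: "v w = y w" if "w \<in> S" for w
  proof -
    have "v w = 1 / w * (w * V n w + (of_nat N - of_nat n) / U n w)"
      unfolding tau_20_eq[OF n that, symmetric] v_def by simp
    also have "\<dots> = y w"
      using S_nonzero(1)[OF that] by (simp add: y_def distrib_left diff_divide_distrib mult.commute)
    finally show ?thesis .
  qed
  note reflection = PV_reflection[OF U_differentiable[OF _ n] V_differentiable[OF _ less_imp_le[OF n]]
      S_nonzero(1) U_nontrivial(1)[OF _ n] PV_U_V[OF n, THEN conjunct1] PV_U_V[OF n, THEN conjunct2], folded y_def]
  show "rational_PV_solution_on (U_dom n \<inter> D)
      (of_nat N - of_nat n, - of_nat N, \<mu> + of_nat N + of_nat n + 1, - of_nat N - \<mu>) (U n) v"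
  proof (rule rational_PV_solution_U_I[OF n, where y = y and
        pv = "Polynomial.smult (of_nat N) (tau 0 0 (Suc n) * tau 2 0 n)" and qv = "[:0, 1:] * (tau 1 0 n * tau 1 0 (Suc n))"])
    show "PV_equation (of_nat N - of_nat n) (\<mu> + of_nat N + of_nat n + 1) (U n) y z" if "z \<in> S" for z
      using reflection(1)[OF that that that that that that] by simp
    show "PV_equation (- of_nat N) (- of_nat N - \<mu>) y (\<lambda>w. 1 - U n w) z" if "z \<in> S" for z
      using reflection(2)[OF that that that that that that] by (simp add: algebra_simps)
  qed (use n vy in \<open>auto simp: D_def v_def S_nonzero(2) dest: S_nonzero(1)\<close>)
  show "v z = 1 - (\<mu> + 2 * of_nat n + 1) / z + (pderiv_log (tau 1 0 n) z - pderiv_log (tau 1 0 (Suc n)) z)" if "z \<in> D"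
  proof (rule pderiv_log_quotient_extend[where c = "\<lambda>z. 1 - (\<mu> + 2 * of_nat n + 1) / z", OF finite_compl_S])
    show "v w = 1 - (\<mu> + 2 * of_nat n + 1) / w + (pderiv_log (tau 1 0 n) w - pderiv_log (tau 1 0 (Suc n)) w)"
      if "w \<in> S" for w
    proof -
      have "pderiv_log (tau 1 0 n) w - pderiv_log (tau 1 0 (Suc n)) w =
          - (1 - (\<mu> + 2 * of_nat n + 1) / w - V n w - (of_nat N - of_nat n) / (w * U n w))"
        using pderiv_log_tau_10[OF n that] by (metis minus_diff_eq)
      then show ?thesis unfolding vy[OF that] y_def by (simp add: diff_divide_distrib)
    qed
  qed (use that in \<open>auto simp: D_def v_def intro!: continuous_intros\<close>)
qed

text \<open>Here \<open>v\<close> is \<open>1 - V (Suc n)\<close>: its equation is the flipped first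
  part of \<open>PV_U_V_Suc\<close>, and that of \<open>U n\<close> is the second part.\<close>

lemma PV_solution_ii:
  assumes n: "n < N"
  defines "D \<equiv> {z. poly (tau 0 1 (Suc n)) z \<noteq> 0 \<and> poly (tau 1 0 (Suc n)) z \<noteq> 0}"
  defines "v \<equiv> \<lambda>z. poly (tau 0 0 (Suc n)) z * poly (tau 1 1 (Suc n)) z / (poly (tau 0 1 (Suc n)) z * poly (tau 1 0 (Suc n)) z)"
  shows "rational_PV_solution_on (U_dom n \<inter> D)
      (of_nat N - of_nat n, \<mu> + of_nat n + 1, - \<mu> - of_nat N - of_nat n - 1, of_nat n + 1) (U n) v"
    and "z \<in> D \<Longrightarrow> v z = 1 + (pderiv_log (tau 0 1 (Suc n)) z - pderiv_log (tau 1 0 (Suc n)) z)"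
proof -
  have vy: "v w = 1 - V (Suc n) w" if "w \<in> S" for w
    unfolding one_minus_V[OF that n] v_def by (simp add: mult.commute)
  show "rational_PV_solution_on (U_dom n \<inter> D)
      (of_nat N - of_nat n, \<mu> + of_nat n + 1, - \<mu> - of_nat N - of_nat n - 1, of_nat n + 1) (U n) v"
  proof (rule rational_PV_solution_U_I[OF n, where y = "\<lambda>w. 1 - V (Suc n) w" and
        pv = "tau 0 0 (Suc n) * tau 1 1 (Suc n)" and qv = "tau 0 1 (Suc n) * tau 1 0 (Suc n)"])
    show "PV_equation (of_nat N - of_nat n) (- \<mu> - of_nat N - of_nat n - 1) (U n) (\<lambda>w. 1 - V (Suc n) w) z"
      if "z \<in> S" for z
      using PV_U_V_Suc(2)[OF n n _ n _ that] by simp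
    show "PV_equation (\<mu> + of_nat n + 1) (of_nat n + 1) (\<lambda>w. 1 - V (Suc n) w) (\<lambda>w. 1 - U n w) z"
      if "z \<in> S" for z
      using PV_U_V_Suc(1)[OF n n _ n _ that] n that by (intro PV_equation_flip V_differentiable) auto
  qed (use n vy in \<open>auto simp: D_def v_def S_nonzero(2) dest: S_nonzero(1)\<close>)
  show "v z = 1 + (pderiv_log (tau 0 1 (Suc n)) z - pderiv_log (tau 1 0 (Suc n)) z)" if "z \<in> D"
  proof (rule pderiv_log_quotient_extend[where c = "\<lambda>z. 1", OF finite_compl_S])
    show "v w = 1 + (pderiv_log (tau 0 1 (Suc n)) w - pderiv_log (tau 1 0 (Suc n)) w)" if "w \<in> S" for w
      using V_eq_pderiv_log[OF that, of "Suc n"] n vy[OF that] by simp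
  qed (use that in \<open>auto simp: D_def v_def intro!: continuous_intros\<close>)
qed

lemma PV_solution_iii:
  assumes n: "n < N"
  defines "D \<equiv> {z. poly (tau 1 0 n) z \<noteq> 0 \<and> poly (tau 0 1 n) z \<noteq> 0}"
  shows "rational_PV_solution_on (U_dom n \<inter> D)
      (of_nat n - of_nat N, - of_nat n, \<mu> + of_nat N + of_nat n + 1, - of_nat n - \<mu>) (U n) (V n)"
    and "z \<in> D \<Longrightarrow> V n z = pderiv_log (tau 1 0 n) z - pderiv_log (tau 0 1 n) z"
proof -
  \<comment> \<open>The numerator of \<open>V n\<close> as a polynomial, zero for
    \<open>n = 0\<close>.\<close>
  define r where "r = (case n of 0 \<Rightarrow> 0 | Suc k \<Rightarrow> - (tau 1 1 k * tau 0 0 (Suc n)))"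
  have V: "V n w = poly r w / poly (tau 1 0 n * tau 0 1 n) w" for w
    by (simp add: V_def r_def split: nat.split)
  show "rational_PV_solution_on (U_dom n \<inter> D)
      (of_nat n - of_nat N, - of_nat n, \<mu> + of_nat N + of_nat n + 1, - of_nat n - \<mu>) (U n) (V n)"
    by (rule rational_PV_solution_U_I[OF n _ _ V _ refl])
      (use PV_U_V[OF n] n in \<open>auto simp: D_def S_nonzero\<close>)
  show "V n z = pderiv_log (tau 1 0 n) z - pderiv_log (tau 0 1 n) z" if "z \<in> D"
  proof -
    have "isCont (V n) z" unfolding V[abs_def] using that by (auto simp: D_def intro!: continuous_intros)
    then show ?thesis
      using pderiv_log_quotient_extend[where c = "\<lambda>z. 0", OF finite_compl_S, of "V n" "tau 1 0 n" "tau 0 1 n" z]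
        V_eq_pderiv_log n that by (simp add: D_def)
  qed
qed

text \<open>As \<open>PV_reflection\<close> acts on the first parameter, the pair
  \<open>(1 - U n, 1 - V n)\<close> is reflected and then flipped back.\<close>

lemma PV_solution_iv:
  assumes n: "n < N"
  defines "D \<equiv> {z. z \<noteq> 0 \<and> poly (tau 0 1 n) z \<noteq> 0 \<and> poly (tau 0 1 (Suc n)) z \<noteq> 0}"
  defines "v \<equiv> \<lambda>z. - ((\<mu> + of_nat N + 1) / z * (poly (tau 0 2 n) z * poly (tau 0 0 (Suc n)) z) / (poly (tau 0 1 n) z * poly (tau 0 1 (Suc n)) z))"
  shows "rational_PV_solution_on (U_dom n \<inter> D)
      (of_nat n - of_nat N, \<mu> + of_nat N + 1, - \<mu> - of_nat N - of_nat n - 1, of_nat N + 1) (U n) v"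
    and "z \<in> D \<Longrightarrow> v z = (\<mu> + 2 * of_nat n + 1) / z + (pderiv_log (tau 0 1 (Suc n)) z - pderiv_log (tau 0 1 n) z)"
proof -
  define k where "k = \<mu> + of_nat N + of_nat n + 1"
  \<comment> \<open>The outer \<open>1 -\<close> is the flip back, so \<open>y w\<close> equals
    \<open>V n w + k / (w * (1 - U n w))\<close>.\<close>
  define y where "y w = 1 - (1 - V n w - k / (w * (1 - U n w)))" for w
  have vy: "v w = y w" if "w \<in> S" for w
  proof -
    have "- (c / z * (p * q) / r) = 1 / z * (- c * (q * p / r))" for c z p q r :: complex by simp
    then have "v w = 1 / w * (w * V n w + k / (1 - U n w))"
      unfolding tau_02_eq[OF n that, folded k_def, symmetric] v_def .
    also have "\<dots> = y w"
      using S_nonzero(1)[OF that] by (simp add: y_def distrib_left)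
    finally show ?thesis .
  qed
  have U': "(\<lambda>w. 1 - U n w) field_differentiable at z" and V': "(\<lambda>w. 1 - V n w) field_differentiable at z"
    if "z \<in> S" for z
    using U_differentiable[OF that n] V_differentiable[OF that less_imp_le[OF n]] by (auto intro!: derivative_intros)
  have y': "(\<lambda>w. 1 - V n w - k / (w * (1 - U n w))) field_differentiable at z" if "z \<in> S" for z
    using U'[OF that] V'[OF that] U_nontrivial(2)[OF that n] S_nonzero(1)[OF that]
    by (auto intro!: derivative_intros)
  have reflection: "PV_equation (- k) (of_nat n - of_nat N) (\<lambda>w. 1 - U n w) (\<lambda>w. 1 - V n w - k / (w * (1 - U n w))) z"
    "PV_equation (- of_nat n - \<mu> + k) (- of_nat n + k) (\<lambda>w. 1 - V n w - k / (w * (1 - U n w))) (\<lambda>w. 1 - (1 - U n w)) z"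
    if z: "z \<in> S" for z
  proof -
    note PV = PV_U_V[OF n z, folded k_def]
    have "PV_equation k (of_nat n - of_nat N) (\<lambda>w. 1 - U n w) (\<lambda>w. 1 - V n w) z"
      using PV U_differentiable[OF z n] by (intro PV_equation_flip) auto
    from PV_reflection[OF U'[OF z] V'[OF z] S_nonzero(1)[OF z] U_nontrivial(2)[OF z n] this]
    have *: "PV_equation r t (\<lambda>w. 1 - V n w) (\<lambda>w. 1 - (1 - U n w)) z \<Longrightarrow>
        k + (of_nat n - of_nat N) + r + t = 1 \<Longrightarrow>
      PV_equation (- k) (of_nat n - of_nat N) (\<lambda>w. 1 - U n w) (\<lambda>w. 1 - V n w - k / (w * (1 - U n w))) z \<and>
      PV_equation (r + k) (t + k) (\<lambda>w. 1 - V n w - k / (w * (1 - U n w))) (\<lambda>w. 1 - (1 - U n w)) z" for r t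
      by blast
    have "PV_equation (- of_nat n - \<mu>) (- of_nat n) (\<lambda>w. 1 - V n w) (\<lambda>w. 1 - (1 - U n w)) z"
      using PV V_differentiable[OF z less_imp_le[OF n]] by (intro PV_equation_flip) auto
    from *[OF this] show
      "PV_equation (- k) (of_nat n - of_nat N) (\<lambda>w. 1 - U n w) (\<lambda>w. 1 - V n w - k / (w * (1 - U n w))) z"
      "PV_equation (- of_nat n - \<mu> + k) (- of_nat n + k) (\<lambda>w. 1 - V n w - k / (w * (1 - U n w))) (\<lambda>w. 1 - (1 - U n w)) z"
      by (simp_all add: k_def)
  qed
  show "rational_PV_solution_on (U_dom n \<inter> D)
      (of_nat n - of_nat N, \<mu> + of_nat N + 1, - \<mu> - of_nat N - of_nat n - 1, of_nat N + 1) (U n) v"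
  proof (rule rational_PV_solution_U_I[OF n, where y = y and
        pv = "Polynomial.smult (- (\<mu> + of_nat N + 1)) (tau 0 2 n * tau 0 0 (Suc n))" and qv = "[:0, 1:] * (tau 0 1 n * tau 0 1 (Suc n))"])
    show "PV_equation (of_nat n - of_nat N) (- \<mu> - of_nat N - of_nat n - 1) (U n) y z" if "z \<in> S" for z
    proof -
      have "- k = - \<mu> - of_nat N - of_nat n - 1" by (simp add: k_def)
      then show ?thesis
        using PV_equation_flip[OF reflection(1)[OF that] U'[OF that]] by (simp add: y_def[abs_def])
    qed
    show "PV_equation (\<mu> + of_nat N + 1) (of_nat N + 1) y (\<lambda>w. 1 - U n w) z" if "z \<in> S" for z
      using PV_equation_flip[OF reflection(2)[OF that] y'[OF that]]
      by (simp add: y_def[abs_def] k_def add_ac)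
    show "v z = poly (Polynomial.smult (- (\<mu> + of_nat N + 1)) (tau 0 2 n * tau 0 0 (Suc n))) z /
        poly ([:0, 1:] * (tau 0 1 n * tau 0 1 (Suc n))) z" for z
      unfolding v_def poly_smult poly_mult mult_minus_left minus_divide_left by simp
  qed (use n vy in \<open>auto simp: D_def S_nonzero(2) dest: S_nonzero(1)\<close>)
  show "v z = (\<mu> + 2 * of_nat n + 1) / z + (pderiv_log (tau 0 1 (Suc n)) z - pderiv_log (tau 0 1 n) z)" if "z \<in> D"
  proof (rule pderiv_log_quotient_extend[where c = "\<lambda>z. (\<mu> + 2 * of_nat n + 1) / z", OF finite_compl_S])
    show "v w = (\<mu> + 2 * of_nat n + 1) / w + (pderiv_log (tau 0 1 (Suc n)) w - pderiv_log (tau 0 1 n) w)"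
      if w: "w \<in> S" for w
    proof -
      define a where "a = (of_nat N - of_nat n) / (w * U n w)"
      define b where "b = k / (w * (1 - U n w))"
      have nz: "w \<noteq> 0" "U n w \<noteq> 0" "1 - U n w \<noteq> 0"
        using S_nonzero(1)[OF w] U_nontrivial[OF w n] by auto
      then have ab: "w * U n w * a = of_nat N - of_nat n" "w * (1 - U n w) * b = k"
        by (simp_all only: a_def b_def times_divide_eq_right nonzero_mult_div_cancel_left mult_eq_0_iff simp_thms)
      \<comment> \<open>Dividing \<open>U_relation\<close> by its common factor trades
        \<open>b\<close> for \<open>a\<close>, so that \<open>pderiv_log_tau_10\<close> applies;
        \<open>V_eq_pderiv_log\<close> then passes from \<open>tau 1 0\<close> to
        \<open>tau 0 1\<close>.\<close>
      have "w * U n w * (1 - U n w) * (V (Suc n) w + V n w - 1 + a + b) =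
          w * U n w * (1 - U n w) * (V (Suc n) w + V n w - 1) + (w * U n w * a) * (1 - U n w) +
          (w * (1 - U n w) * b) * U n w"
        by (simp add: algebra_simps)
      also have "\<dots> = 0"
        unfolding ab using U_relation[OF n w] by (simp add: k_def)
      finally have sum: "V (Suc n) w + V n w - 1 + a + b = 0"
        using nz unfolding mult_eq_0_iff by blast
      have "V n w + b = (V (Suc n) w + V n w - 1 + a + b) + (1 - V (Suc n) w - a)" by simp
      then have "V n w + b = 1 - V (Suc n) w - a" unfolding sum by simp
      moreover have "pderiv_log (tau 0 1 (Suc n)) w - pderiv_log (tau 0 1 n) w =
          pderiv_log (tau 1 0 (Suc n)) w - pderiv_log (tau 1 0 n) w - V (Suc n) w + V n w"
        using V_eq_pderiv_log[OF w, of n] V_eq_pderiv_log[OF w, of "Suc n"] n by simp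
      ultimately show ?thesis
        unfolding pderiv_log_tau_10[OF n w, folded a_def] vy[OF w] y_def b_def[symmetric] by simp
    qed
  qed (use that in \<open>auto simp: D_def v_def intro!: continuous_intros\<close>)
qed

end

section \<open>Translation into generalised Laguerre polynomials\<close>

theorem mainTheorem3:
  fixes \<mu> :: complex and m :: int and n :: nat
  assumes "m \<ge> 1"
  shows
    "(finite (- u_dom m n \<mu>) \<and>
     (\<forall>z\<in>u_dom m n \<mu>.
        u_fun m n \<mu> z = log_deriv (\<lambda>z. T (m - 1) (n + 1) (\<mu> - 1) z / T (m - 1) n (\<mu> + 1) z) z))
     \<and>
     (let D = {z. z \<noteq> 0 \<and> T (m - 1) n \<mu> z \<noteq> 0 \<and> T (m - 2) (n + 1) \<mu> z \<noteq> 0};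
         v = (\<lambda>z. - ((of_int m + of_nat n) / z) *
                (T (m - 1) (n + 1) (\<mu> - 1) z * T (m - 2) n (\<mu> + 1) z) /
                (T (m - 1) n \<mu> z * T (m - 2) (n + 1) \<mu> z))
     in rational_PV_solution_on (u_dom m n \<mu> \<inter> D)
          (of_int m, - of_int m - of_nat n, \<mu> + of_int m + 2 * of_nat n + 1,
           - of_int m - of_nat n - \<mu>)
          (u_fun m n \<mu>) v \<and>
        (\<forall>z\<in>D. v z = 1 - (\<mu> + 2 * of_nat n + 1) / z +
           log_deriv (\<lambda>z. T (m - 1) n \<mu> z / T (m - 2) (n + 1) \<mu> z) z))
     \<and>
     (let D = {z. T (m - 1) (n + 1) \<mu> z \<noteq> 0 \<and> T (m - 2) (n + 1) \<mu> z \<noteq> 0};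
         v = (\<lambda>z. (T (m - 1) (n + 1) (\<mu> - 1) z * T (m - 2) (n + 1) (\<mu> + 1) z) /
                (T (m - 1) (n + 1) \<mu> z * T (m - 2) (n + 1) \<mu> z))
     in rational_PV_solution_on (u_dom m n \<mu> \<inter> D)
          (of_int m, \<mu> + of_nat n + 1, - \<mu> - of_int m - 2 * of_nat n - 1, of_nat n + 1)
          (u_fun m n \<mu>) v \<and>
        (\<forall>z\<in>D. v z = 1 +
           log_deriv (\<lambda>z. T (m - 1) (n + 1) \<mu> z / T (m - 2) (n + 1) \<mu> z) z))
     \<and>
     (let D = {z. T (m - 1) n \<mu> z \<noteq> 0 \<and> T m n \<mu> z \<noteq> 0};
         v = (\<lambda>z. if n = 0 then 0
                else - (T m (n - 1) (\<mu> + 1) z * T (m - 1) (n + 1) (\<mu> - 1) z) /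
                       (T (m - 1) n \<mu> z * T m n \<mu> z))
     in rational_PV_solution_on (u_dom m n \<mu> \<inter> D)
          (- of_int m, - of_nat n, \<mu> + of_int m + 2 * of_nat n + 1, - of_nat n - \<mu>)
          (u_fun m n \<mu>) v \<and>
        (n \<ge> 1 \<longrightarrow> (\<forall>z\<in>D. v z =
           log_deriv (\<lambda>z. T (m - 1) n \<mu> z / T m n \<mu> z) z)))
     \<and>
     (let D = {z. z \<noteq> 0 \<and> T m n \<mu> z \<noteq> 0 \<and> T (m - 1) (n + 1) \<mu> z \<noteq> 0};
         v = (\<lambda>z. ((\<mu> + of_int m + of_nat n + 1) / z) *
                (T m n (\<mu> + 1) z * T (m - 1) (n + 1) (\<mu> - 1) z) /
                (T m n \<mu> z * T (m - 1) (n + 1) \<mu> z))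
     in rational_PV_solution_on (u_dom m n \<mu> \<inter> D)
          (- of_int m, \<mu> + of_int m + of_nat n + 1, - \<mu> - of_int m - 2 * of_nat n - 1,
           of_int m + of_nat n + 1)
          (u_fun m n \<mu>) v \<and>
        (\<forall>z\<in>D. v z = (\<mu> + 2 * of_nat n + 1) / z +
           log_deriv (\<lambda>z. T (m - 1) (n + 1) \<mu> z / T m n \<mu> z) z))"
proof -
  obtain k where m: "m = int k" and k: "k \<ge> 1" using assms zero_le_imp_eq_int[of m] by auto
  define N where "N = k + n"
  have n: "n < N" using k by (simp add: N_def)
  interpret laguerre_chain "laguerre_poly N \<mu>" N \<mu> by (rule laguerre_chain_laguerre_poly)
  note gs = gen_laguerre_poly_eq_tau[OF refl]
  have sign: "(-1) ^ (j * 2) = (1 :: complex poly)" for j :: nat by (simp add: power_mult mult.commute[of j])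
  \<comment> \<open>\<open>N = 1\<close> forces \<open>n = 0\<close>, the empty determinant;
    otherwise \<open>i = 2\<close> is admissible.\<close>
  have index: "n = 0 \<or> 2 \<le> N \<and> m - 2 + int n = int (N - 2)"
    using k by (auto simp: m N_def of_nat_diff)
  \<comment> \<open>The sign exponent \<open>n * (i + j)\<close> can be odd only for
    \<open>i + j = 1\<close>, so only \<open>tau 0 1\<close> and \<open>tau 1 0\<close> carry a
    sign.\<close>
  have T: "T m n \<mu> z = (-1) ^ n * poly (tau 0 1 n) z"
    "T (m - 2) (n + 1) \<mu> z = (-1) ^ Suc n * poly (tau 1 0 (Suc n)) z"
    "T (m - 1) n (\<mu> + 1) z = poly (tau 1 1 n) z"
    "T (m - 1) (n + 1) (\<mu> - 1) z = poly (tau 0 0 (Suc n)) z"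
    "T (m - 2) n (\<mu> + 1) z = poly (tau 2 0 n) z"
    "T (m - 1) n \<mu> z = (-1) ^ n * poly (tau 1 0 n) z"
    "T (m - 1) (n + 1) \<mu> z = (-1) ^ Suc n * poly (tau 0 1 (Suc n)) z"
    "T (m - 2) (n + 1) (\<mu> + 1) z = poly (tau 1 1 (Suc n)) z"
    "T m n (\<mu> + 1) z = poly (tau 0 2 n) z" for z
    using gs[of n 0 m \<mu> 1] gs[of "n + 1" 1 "m - 2" \<mu> 0] gs[of n 1 "m - 1" "\<mu> + 1" 1]
      gs[of "n + 1" 0 "m - 1" "\<mu> - 1" 0] gs[OF index, of "\<mu> + 1" 0] gs[of n 1 "m - 1" \<mu> 0]
      gs[of "n + 1" 0 "m - 1" \<mu> 1] gs[of "n + 1" 1 "m - 2" "\<mu> + 1" 1] gs[of n 0 m "\<mu> + 1" 2] k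
    unfolding T_def
    by (simp_all add: m N_def sign of_nat_diff poly_power del: power_Suc)
  have T': "T m (n - 1) (\<mu> + 1) z = poly (tau 1 1 (n - 1)) z" if "n \<noteq> 0" for z
    using gs[of "n - 1" 1 m "\<mu> + 1" 1] k that unfolding T_def
    by (simp add: m N_def sign of_nat_diff)
  have mN: "of_int m = (of_nat N - of_nat n :: complex)" by (simp add: m N_def)
  \<comment> \<open>Signs of sizes \<open>n\<close> and \<open>Suc n\<close> combine to a minus. It
    absorbs the minus signs in \<open>u\<close> and in case (i) and creates the one in
    \<open>PV_solution_iv\<close>.\<close>
  have cancel: "(-1) ^ n * x * ((-1) ^ n * y) = (x * y :: complex)"
    "(-1) ^ n * x * ((-1) ^ Suc n * y) = (- (x * y) :: complex)"
    "(-1) ^ Suc n * x * ((-1) ^ n * y) = (- (x * y) :: complex)"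
    "(-1) ^ Suc n * x * ((-1) ^ Suc n * y) = (x * y :: complex)" for x y
    by (cases "even n"; simp)+
  have nz: "(-1) ^ j * x \<noteq> 0 \<longleftrightarrow> x \<noteq> (0 :: complex)" for j x by simp
  have u: "u_fun m n \<mu> = U n"
    by (intro ext) (simp only: u_fun_def T cancel U_def minus_minus)
  have dom: "u_dom m n \<mu> = U_dom n"
    by (simp only: u_dom_def T U_dom_def)
  have dom_finite: "finite (- u_dom m n \<mu>)"
    unfolding dom by (rule finite_subset[OF _ finite_compl_S]) (use n in \<open>auto simp: U_dom_def S_nonzero(2)\<close>)
  have u_log: "\<forall>z\<in>u_dom m n \<mu>. u_fun m n \<mu> z =
      log_deriv (\<lambda>z. T (m - 1) (n + 1) (\<mu> - 1) z / T (m - 1) n (\<mu> + 1) z) z"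
    unfolding dom u T using U_log_deriv[OF n] by (simp add: log_deriv_poly_quotient U_dom_def)
  let ?Di = "{z. z \<noteq> 0 \<and> T (m - 1) n \<mu> z \<noteq> 0 \<and> T (m - 2) (n + 1) \<mu> z \<noteq> 0}"
  let ?vi = "\<lambda>z. - ((of_int m + of_nat n) / z) *
                (T (m - 1) (n + 1) (\<mu> - 1) z * T (m - 2) n (\<mu> + 1) z) /
                (T (m - 1) n \<mu> z * T (m - 2) (n + 1) \<mu> z)"
  have vi: "?vi = (\<lambda>z. of_nat N / z * (poly (tau 0 0 (Suc n)) z * poly (tau 2 0 n) z) /
      (poly (tau 1 0 n) z * poly (tau 1 0 (Suc n)) z))"
    unfolding T cancel mN by simp
  have i: "rational_PV_solution_on (u_dom m n \<mu> \<inter> ?Di)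
      (of_int m, - of_int m - of_nat n, \<mu> + of_int m + 2 * of_nat n + 1, - of_int m - of_nat n - \<mu>)
      (u_fun m n \<mu>) ?vi"
    unfolding vi unfolding u dom T nz mN using PV_solution_i(1)[OF n] by (simp add: algebra_simps)
  have i_log: "\<forall>z\<in>?Di. ?vi z = 1 - (\<mu> + 2 * of_nat n + 1) / z +
      log_deriv (\<lambda>z. T (m - 1) n \<mu> z / T (m - 2) (n + 1) \<mu> z) z"
    using PV_solution_i(2)[OF n] unfolding fun_cong[OF vi] unfolding T nz
    by (auto simp: log_deriv_signed_poly_quotient log_deriv_poly_quotient simp del: power_Suc)
  let ?Dii = "{z. T (m - 1) (n + 1) \<mu> z \<noteq> 0 \<and> T (m - 2) (n + 1) \<mu> z \<noteq> 0}"
  let ?vii = "\<lambda>z. (T (m - 1) (n + 1) (\<mu> - 1) z * T (m - 2) (n + 1) (\<mu> + 1) z) /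
                (T (m - 1) (n + 1) \<mu> z * T (m - 2) (n + 1) \<mu> z)"
  have vii: "?vii = (\<lambda>z. poly (tau 0 0 (Suc n)) z * poly (tau 1 1 (Suc n)) z /
      (poly (tau 0 1 (Suc n)) z * poly (tau 1 0 (Suc n)) z))"
    unfolding T cancel ..
  have ii: "rational_PV_solution_on (u_dom m n \<mu> \<inter> ?Dii)
      (of_int m, \<mu> + of_nat n + 1, - \<mu> - of_int m - 2 * of_nat n - 1, of_nat n + 1)
      (u_fun m n \<mu>) ?vii"
    unfolding vii unfolding u dom T nz mN using PV_solution_ii(1)[OF n] by (simp add: algebra_simps)
  have ii_log: "\<forall>z\<in>?Dii. ?vii z = 1 +
      log_deriv (\<lambda>z. T (m - 1) (n + 1) \<mu> z / T (m - 2) (n + 1) \<mu> z) z"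
    using PV_solution_ii(2)[OF n] unfolding fun_cong[OF vii] unfolding T nz
    by (auto simp: log_deriv_signed_poly_quotient log_deriv_poly_quotient simp del: power_Suc)
  let ?Diii = "{z. T (m - 1) n \<mu> z \<noteq> 0 \<and> T m n \<mu> z \<noteq> 0}"
  let ?viii = "\<lambda>z. if n = 0 then 0
                else - (T m (n - 1) (\<mu> + 1) z * T (m - 1) (n + 1) (\<mu> - 1) z) /
                       (T (m - 1) n \<mu> z * T m n \<mu> z)"
  have viii: "?viii = V n"
  proof (cases "n = 0")
    case False
    then have "V n z = - (poly (tau 1 1 (n - 1)) z * poly (tau 0 0 (Suc n)) z) /
        (poly (tau 1 0 n) z * poly (tau 0 1 n) z)" for z
      by (cases n) (simp_all add: V_def)
    with False show ?thesis
      by (intro ext) (simp only: T T'[OF False] cancel if_False)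
  qed (simp add: V_def[abs_def])
  have iii: "rational_PV_solution_on (u_dom m n \<mu> \<inter> ?Diii)
      (- of_int m, - of_nat n, \<mu> + of_int m + 2 * of_nat n + 1, - of_nat n - \<mu>)
      (u_fun m n \<mu>) ?viii"
    unfolding viii unfolding u dom T nz mN using PV_solution_iii(1)[OF n] by (simp add: algebra_simps)
  have iii_log: "n \<ge> 1 \<longrightarrow> (\<forall>z\<in>?Diii. ?viii z = log_deriv (\<lambda>z. T (m - 1) n \<mu> z / T m n \<mu> z) z)"
    using PV_solution_iii(2)[OF n] unfolding fun_cong[OF viii] unfolding T nz
    by (auto simp: log_deriv_signed_poly_quotient log_deriv_poly_quotient simp del: power_Suc)
  let ?Div = "{z. z \<noteq> 0 \<and> T m n \<mu> z \<noteq> 0 \<and> T (m - 1) (n + 1) \<mu> z \<noteq> 0}"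
  let ?viv = "\<lambda>z. ((\<mu> + of_int m + of_nat n + 1) / z) *
                (T m n (\<mu> + 1) z * T (m - 1) (n + 1) (\<mu> - 1) z) /
                (T m n \<mu> z * T (m - 1) (n + 1) \<mu> z)"
  have viv: "?viv = (\<lambda>z. - ((\<mu> + of_nat N + 1) / z * (poly (tau 0 2 n) z * poly (tau 0 0 (Suc n)) z) /
      (poly (tau 0 1 n) z * poly (tau 0 1 (Suc n)) z)))"
    unfolding T cancel mN by simp
  have iv: "rational_PV_solution_on (u_dom m n \<mu> \<inter> ?Div)
      (- of_int m, \<mu> + of_int m + of_nat n + 1, - \<mu> - of_int m - 2 * of_nat n - 1, of_int m + of_nat n + 1)
      (u_fun m n \<mu>) ?viv"
    unfolding viv unfolding u dom T nz mN using PV_solution_iv(1)[OF n] by (simp add: algebra_simps)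
  have iv_log: "\<forall>z\<in>?Div. ?viv z = (\<mu> + 2 * of_nat n + 1) / z +
      log_deriv (\<lambda>z. T (m - 1) (n + 1) \<mu> z / T m n \<mu> z) z"
    using PV_solution_iv(2)[OF n] unfolding fun_cong[OF viv] unfolding T nz
    by (auto simp: log_deriv_signed_poly_quotient log_deriv_poly_quotient simp del: power_Suc)
  show ?thesis
    unfolding Let_def
    by (intro conjI dom_finite u_log i i_log ii ii_log iii iii_log iv iv_log)
qed

end
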